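(* Let $p\ge 0$ be an integer. The error $L_m^p(t)v=\varphi_p(\sigma tA)v - V_m\varphi_p(\sigma tT_m)e_1$ of the Krylov approximation to $\varphi_p(\sigma tA)v$ satisfies, as $t\to 0$, $$L_m^p(t)v=\tau_{m+1,m}\,\gamma_m\,\frac{(\sigma t)^m}{(m+p)!}\,v_{m+1}+\mathcal{O}(t^{m+1}).$$ Furthermore, in the nonexpansive case $\mu_2(\sigma A)\le 0$, for all $t\ge 0$, $$\|L_m^p(t)v\|_2\le \tau_{m+1,m}\,\gamma_m\,\frac{t^m}{(m+p)!},$$ and this bound is asymptotically correct for $t\to 0$, i.e. $\|L_m^p(t)v\|_2=\tau_{m+1,m}\,\gamma_m\,\frac{t^m}{(m+p)!}+\mathcal{O}(t^{m+1})$.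
   Context: Setting: $A\in\mathbb{C}^{n\times n}$, $\sigma\in\mathbb{C}$ with $|\sigma|=1$, $v\in\mathbb{C}^n$ with $\|v\|_2=1$, $t\ge 0$ real, and $m\ge 1$ an integer. Krylov decomposition: the Arnoldi iteration (Lanczos if $A$ is Hermitian) applied to $A$ and $v$ is assumed to run until dimension $m$ without breakdown (i.e. $v,Av,\dots,A^m v$ are linearly independent). It yields a matrix $V_m\in\mathbb{C}^{n\times m}$ with $V_m^*V_m=I$ whose columns span $\mathcal{K}_m(A,v)=\mathrm{span}\{v,Av,\dots,A^{m-1}v\}$ and whose first column is $v$ (so $V_me_1=v$), an upper Hessenberg matrix $T_m=V_m^*AV_m\in\mathbb{C}^{m\times m}$ with positive lower diagonal entries $(T_m)_{j+1,j}>0$, a number $\tau_{m+1,m}>0$ and a vector $v_{m+1}\in\mathbb{C}^n$ with $\|v_{m+1}\|_2=1$, $V_m^*v_{m+1}=0$, such that $$A V_m = V_mT_m + \tau_{m+1,m}\,v_{m+1}e_m^*.$$ Here $e_1=(1,0,\dots,0)^*$ and $e_m=(0,\dots,0,1)^*$ in $\mathbb{C}^m$. Notation: $\gamma_m=e_m^*T_m^{m-1}e_1=\prod_{j=1}^{m-1}(T_m)_{j+1,j}$. The $\varphi$-functions are $\varphi_p(z)=\sum_{k=0}^\infty \frac{z^k}{(k+p)!}$ for integers $p\ge 0$ (so $\varphi_0(z)=\mathrm{e}^z$), applied to matrices via the power series. Nonexpansive case: $\mu_2(\sigma A)\le 0$, where $\mu_2$ is the logarithmic norm associated with the 2-norm;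 equivalently the field of values $W(\sigma A)=\{x^*\sigma A x:\|x\|_2=1\}$ is contained in $\mathbb{C}_-=\{z:\mathrm{Re}\,z\le 0\}$. *)

theory Defs
  imports
    "HOL-Analysis.Analysis"
    "HOL-Library.Landau_Symbols"
    "Jordan_Normal_Form.Schur_Decomposition"
    "Jordan_Normal_Form.VS_Connect"
begin

definition vec_norm2 :: "complex vec \<Rightarrow> real" where
  "vec_norm2 x = L2_set (\<lambda>i. cmod (x $ i)) {..<dim_vec x}"

definition mat_norm2 :: "complex mat \<Rightarrow> real" where
  "mat_norm2 M = (SUP x \<in> {x \<in> carrier_vec (dim_col M). vec_norm2 x = 1}. vec_norm2 (M *\<^sub>v x))"

text \<open>For a square matrix of dimension at least one the limit exists, since
  the difference quotient is nondecreasing in \<open>h\<close> (convexity of the norm) and bounded below by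
  minus the norm of \<open>M\<close>.\<close>

definition log_norm2 :: "complex mat \<Rightarrow> real" where
  "log_norm2 M =
     Lim (at_right 0) (\<lambda>h. (mat_norm2 (1\<^sub>m (dim_row M) + complex_of_real h \<cdot>\<^sub>m M) - 1) / h)"

text \<open>The type of matrices carries no topology, so the power series
  \<open>\<Sum>k. M^k / (k + p)!\<close> is summed entry by entry; every entry converges absolutely.\<close>

definition phi_mat :: "nat \<Rightarrow> complex mat \<Rightarrow> complex mat" where
  "phi_mat p M =
     mat (dim_row M) (dim_row M) (\<lambda>(i, j). \<Sum>k. (M ^\<^sub>m k) $$ (i, j) / fact (k + p))"

abbreviation krylov_vec :: "complex mat \<Rightarrow> complex vec \<Rightarrow> nat \<Rightarrow> complex vec" where
  "krylov_vec A v k \<equiv> (A ^\<^sub>m k) *\<^sub>v v"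

definition krylov_space :: "nat \<Rightarrow> nat \<Rightarrow> complex mat \<Rightarrow> complex vec \<Rightarrow> complex vec set" where
  "krylov_space n m A v =
     LinearCombinations.module.span class_ring (module_vec TYPE(complex) n) (krylov_vec A v ` {..<m})"

text \<open>Indices start at \<open>0\<close>: column \<open>0\<close> of \<open>V\<close> is the starting vector, and \<open>e\<^sub>1\<close>, \<open>e\<^sub>m\<close> are
  \<open>unit_vec m 0\<close>, \<open>unit_vec m (m - 1)\<close>. The product \<open>w e\<^sub>m\<^sup>*\<close> of a column and a row is written as a
  product of an \<open>n \<times> 1\<close> and a \<open>1 \<times> m\<close> matrix; \<open>w\<close> is the vector called \<open>v\<^sub>m\<^sub>+\<^sub>1\<close> in the
  literature and \<open>\<tau>\<close> the number \<open>\<tau>\<^sub>m\<^sub>+\<^sub>1\<^sub>,\<^sub>m\<close>.\<close>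

definition krylov_decomposition ::
  "nat \<Rightarrow> nat \<Rightarrow> complex mat \<Rightarrow> complex vec \<Rightarrow> complex mat \<Rightarrow> complex mat \<Rightarrow> real \<Rightarrow> complex vec \<Rightarrow> bool"
where
  "krylov_decomposition n m A v V T \<tau> w \<longleftrightarrow>
     \<comment> \<open>no breakdown\<close>
     inj_on (krylov_vec A v) {..m} \<and>
     \<not> LinearCombinations.module.lin_dep class_ring (module_vec TYPE(complex) n)
         (krylov_vec A v ` {..m}) \<and>
     V \<in> carrier_mat n m \<and>
     mat_adjoint V * V = 1\<^sub>m m \<and>
     LinearCombinations.module.span class_ring (module_vec TYPE(complex) n) (set (cols V)) =
       krylov_space n m A v \<and>
     col V 0 = v \<and>
     T = mat_adjoint V * A * V \<and>
     (\<forall>i<m. \<forall>j<m. j + 1 < i \<longrightarrow> T $$ (i, j) = 0) \<and>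
     (\<forall>j. j + 1 < m \<longrightarrow> T $$ (j + 1, j) \<in> \<real> \<and> 0 < Re (T $$ (j + 1, j))) \<and>
     0 < \<tau> \<and>
     w \<in> carrier_vec n \<and>
     vec_norm2 w = 1 \<and>
     mat_adjoint V *\<^sub>v w = 0\<^sub>v m \<and>
     A * V = V * T +
       complex_of_real \<tau> \<cdot>\<^sub>m (mat_of_cols n [w] * mat_of_rows m [unit_vec m (m - 1)])"

text \<open>The number \<open>e\<^sub>m\<^sup>* T\<^sup>m\<^sup>-\<^sup>1 e\<^sub>1\<close>, which is real and positive for the matrices \<open>T\<close> of a Krylov
  decomposition; see \<open>krylov_gamma_eq\<close> below.\<close>

definition krylov_gamma :: "nat \<Rightarrow> complex mat \<Rightarrow> real" where
  "krylov_gamma m T = Re ((T ^\<^sub>m (m - 1)) $$ (m - 1, 0))"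

lemma hessenberg_power_entry:
  fixes T :: "complex mat"
  assumes T: "T \<in> carrier_mat m m"
    and hess: "\<forall>i<m. \<forall>j<m. j + 1 < i \<longrightarrow> T $$ (i, j) = 0"
  shows "k < m \<Longrightarrow> k \<le> i \<Longrightarrow> i < m \<Longrightarrow>
    (T ^\<^sub>m k) $$ (i, 0) = (if i = k then \<Prod>j<k. T $$ (j + 1, j) else 0)"
proof (induction k arbitrary: i)
  case 0
  then show ?case using T by auto
next
  case (Suc k)
  have Tk: "T ^\<^sub>m k \<in> carrier_mat m m" using T by simp
  have "T ^\<^sub>m Suc k = T * T ^\<^sub>m k"
    using T Tk by (induction k) (simp_all add: assoc_mult_mat[of _ m m _ m _ m])
  then have "(T ^\<^sub>m Suc k) $$ (i, 0) = (\<Sum>l<m. T $$ (i, l) * (T ^\<^sub>m k) $$ (l, 0))"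
    using T Tk Suc.prems by (simp add: scalar_prod_def atLeast0LessThan)
  also have "\<dots> = (\<Sum>l<m. if l = k then T $$ (i, k) * (\<Prod>j<k. T $$ (j + 1, j)) else 0)"
  proof (rule sum.cong[OF refl])
    fix l assume "l \<in> {..<m}"
    then show "T $$ (i, l) * (T ^\<^sub>m k) $$ (l, 0) =
        (if l = k then T $$ (i, k) * (\<Prod>j<k. T $$ (j + 1, j)) else 0)"
      using Suc.IH[of l] Suc.prems hess by (cases "l < k") auto
  qed
  also have "\<dots> = T $$ (i, k) * (\<Prod>j<k. T $$ (j + 1, j))"
    using Suc.prems by simp
  also have "\<dots> = (if i = Suc k then \<Prod>j<Suc k. T $$ (j + 1, j) else 0)"
    using Suc.prems hess by (auto simp: mult.commute)
  finally show ?case .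
qed

lemma krylov_gamma_eq:
  assumes "krylov_decomposition n m A v V T \<tau> w" "1 \<le> m"
  shows "complex_of_real (krylov_gamma m T) = (T ^\<^sub>m (m - 1)) $$ (m - 1, 0)"
    and "complex_of_real (krylov_gamma m T) = (\<Prod>j<m - 1. T $$ (j + 1, j))"
    and "krylov_gamma m T = (\<Prod>j<m - 1. Re (T $$ (j + 1, j)))"
    and "0 < krylov_gamma m T"
proof -
  have V: "V \<in> carrier_mat n m" and T: "T = mat_adjoint V * A * V"
    and hess: "\<forall>i<m. \<forall>j<m. j + 1 < i \<longrightarrow> T $$ (i, j) = 0"
    and sub: "\<And>j. j + 1 < m \<Longrightarrow> T $$ (j + 1, j) \<in> \<real> \<and> 0 < Re (T $$ (j + 1, j))"
    using assms unfolding krylov_decomposition_def by auto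
  have Tc: "T \<in> carrier_mat m m" using V T by (auto simp: mat_adjoint_def)
  have entry: "(T ^\<^sub>m (m - 1)) $$ (m - 1, 0) = (\<Prod>j<m - 1. T $$ (j + 1, j))"
    using hessenberg_power_entry[OF Tc hess, of "m - 1" "m - 1"] assms(2) by simp
  also have "\<dots> = (\<Prod>j<m - 1. complex_of_real (Re (T $$ (j + 1, j))))"
    by (rule prod.cong) (use sub in auto)
  finally have re: "(T ^\<^sub>m (m - 1)) $$ (m - 1, 0) =
      complex_of_real (\<Prod>j<m - 1. Re (T $$ (j + 1, j)))"
    by simp
  show g: "krylov_gamma m T = (\<Prod>j<m - 1. Re (T $$ (j + 1, j)))"
    unfolding krylov_gamma_def re by (rule Re_complex_of_real)
  show "complex_of_real (krylov_gamma m T) = (T ^\<^sub>m (m - 1)) $$ (m - 1, 0)"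
    unfolding g re ..
  then show "complex_of_real (krylov_gamma m T) = (\<Prod>j<m - 1. T $$ (j + 1, j))"
    using entry by simp
  show "0 < krylov_gamma m T" unfolding g by (rule prod_pos) (use sub in auto)
qed

definition krylov_error ::
  "nat \<Rightarrow> nat \<Rightarrow> complex \<Rightarrow> complex mat \<Rightarrow> complex vec \<Rightarrow> complex mat \<Rightarrow> complex mat \<Rightarrow> real \<Rightarrow> complex vec"
where
  "krylov_error p m \<sigma> A v V T t =
     phi_mat p ((\<sigma> * complex_of_real t) \<cdot>\<^sub>m A) *\<^sub>v v -
     V *\<^sub>v (phi_mat p ((\<sigma> * complex_of_real t) \<cdot>\<^sub>m T) *\<^sub>v unit_vec m 0)"

end

theory Submission
  imports Defs
begin

text \<open>
Put \<open>M = \<sigma> A\<close> and \<open>N = \<sigma> T\<close>. The error of the approximation to \<open>\<phi>\<^sub>p\<close> is the power series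
\<open>\<Sum>k. t\<^sup>k d\<^sub>k / (k + p)!\<close> with the defects \<open>d\<^sub>k = M\<^sup>k v - V N\<^sup>k e\<^sub>1\<close>. The Krylov decomposition turns into
the recurrence \<open>d\<^sub>k\<^sub>+\<^sub>1 = M d\<^sub>k + \<sigma> \<tau> f\<^sub>k w\<close>, where \<open>f\<^sub>k\<close> is the last component of \<open>N\<^sup>k e\<^sub>1\<close>
(\<open>defect_Suc\<close>). Since \<open>N\<close> is upper Hessenberg, \<open>f\<^sub>k\<close> vanishes for \<open>k < m - 1\<close>, and
\<open>f\<^sub>m\<^sub>-\<^sub>1 = \<sigma>\<^sup>m\<^sup>-\<^sup>1 \<gamma>\<^sub>m\<close>. Hence \<open>d\<^sub>k = 0\<close> for \<open>k < m\<close> and \<open>d\<^sub>m = \<tau> \<gamma>\<^sub>m \<sigma>\<^sup>m w\<close>: the series begins with the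
asserted leading term, and the rest of it is \<open>O(t\<^sup>m\<^sup>+\<^sup>1)\<close> (\<open>defect_expansion\<close>).

For the bound, a nonpositive logarithmic norm of \<open>M\<close> means \<open>Re (x\<^sup>* M x) \<le> 0\<close> for all \<open>x\<close>
(\<open>dissipative_of_log_norm2_nonpos\<close>). This property passes to the compression \<open>N = V\<^sup>* M V\<close>, whose
eigenvalues therefore lie in the left half-plane. Three estimates follow, all of them instances of one
energy argument (\<open>L2_growth_bound\<close>).

\<^item> The function \<open>e\<^sub>m\<^sup>* exp(t N) e\<^sub>1\<close> has coefficients \<open>f\<^sub>k\<close>, which satisfy the linear recurrence whose
  characteristic roots are the eigenvalues of \<open>N\<close>. Removing one root at a time gives
  \<open>\<bar>e\<^sub>m\<^sup>* exp(t N) e\<^sub>1\<bar> \<le> \<gamma>\<^sub>m t\<^sup>m\<^sup>-\<^sup>1 / (m - 1)!\<close> (\<open>egf_stable_recurrence_bound\<close>).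
\<^item> The error for \<open>p = 0\<close> solves a dissipative system forced by \<open>\<sigma> \<tau> (e\<^sub>m\<^sup>* exp(t N) e\<^sub>1) w\<close> and starts at
  zero, so its norm is at most the integral \<open>\<tau> \<gamma>\<^sub>m t\<^sup>m / m!\<close>.
\<^item> The error for \<open>p\<close>, multiplied by \<open>t\<^sup>p\<close>, is the derivative of the same expression for \<open>p + 1\<close>. So each
  increase of \<open>p\<close> integrates the bound once, which yields \<open>\<tau> \<gamma>\<^sub>m t\<^sup>m\<^sup>+\<^sup>p / (m + p)!\<close> (\<open>egf_defect_bound\<close>).

That the bound is asymptotically sharp is the expansion combined with the reverse triangle inequality,
since \<open>w\<close> is a unit vector.
\<close>

section \<open>Growth of solutions of dissipative linear equations\<close>

lemma L2_set_sq: "(L2_set f A)\<^sup>2 = (\<Sum>i\<in>A. (f i)\<^sup>2)"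
  by (simp add: L2_set_def sum_nonneg)

lemma cmod_sum_cnj_mult_le:
  "cmod (\<Sum>i\<in>A. cnj (x i) * y i) \<le> L2_set (\<lambda>i. cmod (x i)) A * L2_set (\<lambda>i. cmod (y i)) A"
proof -
  have "cmod (\<Sum>i\<in>A. cnj (x i) * y i) \<le> (\<Sum>i\<in>A. cmod (cnj (x i) * y i))" by (rule norm_sum)
  also have "\<dots> = (\<Sum>i\<in>A. \<bar>cmod (x i)\<bar> * \<bar>cmod (y i)\<bar>)" by (simp add: norm_mult)
  also have "\<dots> \<le> L2_set (\<lambda>i. cmod (x i)) A * L2_set (\<lambda>i. cmod (y i)) A" by (rule L2_set_mult_ineq)
  finally show ?thesis .
qed

text \<open>For \<open>y' = M y + g\<close> with \<open>M\<close> dissipative, \<open>1/2 d/ds \<parallel>y\<parallel>\<^sup>2 = Re \<langle>y, y'\<rangle> \<le> \<parallel>y\<parallel> \<parallel>g\<parallel>\<close>, so the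
norm grows at most as fast as the integral of \<open>\<parallel>g\<parallel>\<close>. The hypothesis \<open>diss\<close> is this energy
inequality itself, with an antiderivative \<open>b\<close> in place of the integral; in this form the same
lemma serves for scalar equations, for systems and for pure integration (\<open>M = 0\<close>). The index set is
a finite set rather than a type because the dimension varies with the matrices.\<close>

lemma L2_growth_bound:
  fixes y y' :: "'i \<Rightarrow> real \<Rightarrow> complex" and b b' :: "real \<Rightarrow> real"
  assumes fin: "finite I"
    and dy: "\<And>i s. i \<in> I \<Longrightarrow> 0 \<le> s \<Longrightarrow> (y i has_vector_derivative y' i s) (at s)"
    and db: "\<And>s. 0 \<le> s \<Longrightarrow> (b has_real_derivative b' s) (at s)"
    and diss: "\<And>s. 0 \<le> s \<Longrightarrow>
      Re (\<Sum>i\<in>I. cnj (y i s) * y' i s) \<le> L2_set (\<lambda>i. cmod (y i s)) I * b' s"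
    and nonneg: "\<And>s. 0 \<le> s \<Longrightarrow> 0 \<le> b' s"
    and t: "0 \<le> t"
  shows "L2_set (\<lambda>i. cmod (y i t)) I \<le> L2_set (\<lambda>i. cmod (y i 0)) I + b t - b 0"
proof (rule field_le_epsilon)
  fix e :: real assume e: "0 < e"
  \<comment> \<open>The norm is not differentiable where \<open>y\<close> vanishes, so it is replaced by the smooth
    majorant \<open>r\<close>, which exceeds it by at most \<open>e\<close>.\<close>
  define q where "q s = (\<Sum>i\<in>I. (cmod (y i s))\<^sup>2)" for s
  define r where "r s = sqrt (q s + e\<^sup>2)" for s
  have q0: "0 \<le> q s" for s unfolding q_def by (simp add: sum_nonneg)
  have L2: "L2_set (\<lambda>i. cmod (y i s)) I = sqrt (q s)" for s
    unfolding q_def L2_set_def ..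
  have dq: "(q has_real_derivative 2 * Re (\<Sum>i\<in>I. cnj (y i s) * y' i s)) (at s)" if s: "0 \<le> s" for s
  proof -
    have 1: "((\<lambda>s. (cmod (y i s))\<^sup>2) has_real_derivative 2 * Re (cnj (y i s) * y' i s)) (at s)"
      if i: "i \<in> I" for i
    proof -
      have "((\<lambda>s. Re (y i s)) has_real_derivative Re (y' i s)) (at s)"
        "((\<lambda>s. Im (y i s)) has_real_derivative Im (y' i s)) (at s)"
        using bounded_linear.has_vector_derivative[OF bounded_linear_Re dy[OF i s]]
          bounded_linear.has_vector_derivative[OF bounded_linear_Im dy[OF i s]]
        by (simp_all add: has_real_derivative_iff_has_vector_derivative)
      from DERIV_add[OF DERIV_power[OF this(1), of 2] DERIV_power[OF this(2), of 2]]
      have "((\<lambda>s. (Re (y i s))\<^sup>2 + (Im (y i s))\<^sup>2) has_real_derivative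
          2 * Re (cnj (y i s) * y' i s)) (at s)"
        by (simp add: algebra_simps)
      then show ?thesis by (simp add: cmod_power2)
    qed
    show ?thesis unfolding q_def Re_sum sum_distrib_left
      by (rule DERIV_sum) (rule 1)
  qed
  have pos: "0 < q s + e\<^sup>2" for s using add_nonneg_pos[OF q0, of "e\<^sup>2"] e by simp
  have rpos: "0 < r s" for s unfolding r_def using pos by simp
  define r' where "r' s = Re (\<Sum>i\<in>I. cnj (y i s) * y' i s) / r s" for s
  have dr: "(r has_real_derivative r' s) (at s)" if "0 \<le> s" for s
  proof -
    define D where "D = Re (\<Sum>i\<in>I. cnj (y i s) * y' i s)"
    have "((\<lambda>s. q s + e\<^sup>2) has_real_derivative 2 * D) (at s)"
      using DERIV_add[OF dq[OF that] DERIV_const, of "e\<^sup>2"] by (simp add: D_def)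
    note DERIV_chain2[OF DERIV_real_sqrt[OF pos] this]
    moreover have "inverse (sqrt (q s + e\<^sup>2)) / 2 * (2 * D) = r' s"
      unfolding r'_def r_def D_def[symmetric] by (simp only: divide_inverse) simp
    moreover have "r = (\<lambda>s. sqrt (q s + e\<^sup>2))" by (rule ext) (rule r_def)
    ultimately show ?thesis by (simp only:)
  qed
  have le: "r' s \<le> b' s" if s: "0 \<le> s" for s
  proof -
    have "sqrt (q s) \<le> r s" unfolding r_def using e by simp
    then have "Re (\<Sum>i\<in>I. cnj (y i s) * y' i s) \<le> r s * b' s"
      using order_trans[OF diss[OF s, unfolded L2] mult_right_mono[OF _ nonneg[OF s]]] by blast
    then show ?thesis unfolding r'_def using rpos[of s] by (simp add: field_simps)
  qed
  have "r t - b t \<le> r 0 - b 0"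
  proof (rule DERIV_nonpos_imp_nonincreasing[OF t, of "\<lambda>s. r s - b s"])
    fix s :: real assume s: "0 \<le> s" "s \<le> t"
    show "\<exists>D. ((\<lambda>s. r s - b s) has_real_derivative D) (at s) \<and> D \<le> 0"
      using DERIV_diff[OF dr[OF s(1)] db[OF s(1)]] le[OF s(1)] by auto
  qed
  moreover have "sqrt (q t) \<le> r t" unfolding r_def using e by simp
  moreover have "r 0 \<le> sqrt (q 0) + e"
    unfolding r_def using sqrt_add_le_add_sqrt[of "q 0" "e\<^sup>2"] q0 e by simp
  ultimately show "L2_set (\<lambda>i. cmod (y i t)) I \<le> L2_set (\<lambda>i. cmod (y i 0)) I + b t - b 0 + e"
    unfolding L2 by linarith
qed

section \<open>Exponential generating functions\<close>

definition egf :: "(nat \<Rightarrow> complex) \<Rightarrow> real \<Rightarrow> complex" where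
  "egf a t = (\<Sum>k. a k * of_real t ^ k / fact k)"

text \<open>Entries of matrix powers satisfy this bound, and it makes all power series below entire. It is stated
with \<open>1 \<le> R\<close> so that it survives a delay of the sequence.\<close>

definition geom_bounded :: "(nat \<Rightarrow> complex) \<Rightarrow> bool" where
  "geom_bounded a \<longleftrightarrow> (\<exists>C R. 1 \<le> R \<and> (\<forall>k. cmod (a k) \<le> C * R ^ k))"

lemma geom_boundedI: "(\<And>k. cmod (a k) \<le> C * R ^ k) \<Longrightarrow> 1 \<le> R \<Longrightarrow> geom_bounded a"
  unfolding geom_bounded_def by blast

lemma geom_boundedE:
  assumes "geom_bounded a"
  obtains C R where "0 \<le> C" "1 \<le> R" "\<And>k. cmod (a k) \<le> C * R ^ k"
proof -
  obtain C R where a: "1 \<le> R" "\<And>k. cmod (a k) \<le> C * R ^ k"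
    using assms unfolding geom_bounded_def by auto
  moreover have "0 \<le> C" using order_trans[OF norm_ge_zero a(2)[of 0]] by simp
  ultimately show thesis using that by blast
qed

lemma geom_bounded_zero: "geom_bounded (\<lambda>k. 0)"
  by (rule geom_boundedI[of _ 0 1]) auto

lemma geom_bounded_add:
  assumes "geom_bounded a" "geom_bounded b" shows "geom_bounded (\<lambda>k. a k + b k)"
proof -
  obtain C R where C: "0 \<le> C" and a: "1 \<le> R" "\<And>k. cmod (a k) \<le> C * R ^ k"
    using geom_boundedE[OF assms(1)] by blast
  obtain D S where D: "0 \<le> D" and b: "1 \<le> S" "\<And>k. cmod (b k) \<le> D * S ^ k"
    using geom_boundedE[OF assms(2)] by blast
  show ?thesis
  proof (rule geom_boundedI[of _ "C + D" "max R S"])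
    fix k
    have "C * R ^ k \<le> C * max R S ^ k" "D * S ^ k \<le> D * max R S ^ k"
      using a(1) b(1) C D by (auto intro!: mult_left_mono power_mono)
    then show "cmod (a k + b k) \<le> (C + D) * max R S ^ k"
      using norm_triangle_ineq[of "a k" "b k"] a(2)[of k] b(2)[of k] by (simp add: algebra_simps)
  qed (use a in auto)
qed

lemma geom_bounded_cmult:
  assumes "geom_bounded a" shows "geom_bounded (\<lambda>k. c * a k)"
proof -
  obtain C R where C: "0 \<le> C" and a: "1 \<le> R" "\<And>k. cmod (a k) \<le> C * R ^ k"
    using geom_boundedE[OF assms] by blast
  show ?thesis
  proof (rule geom_boundedI[of _ "cmod c * C" R])
    show "cmod (c * a k) \<le> cmod c * C * R ^ k" for k
      unfolding norm_mult mult.assoc by (intro mult_left_mono a norm_ge_zero)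
  qed (rule a)
qed

lemma geom_bounded_diff:
  assumes "geom_bounded a" "geom_bounded b" shows "geom_bounded (\<lambda>k. a k - b k)"
  using geom_bounded_add[OF assms(1) geom_bounded_cmult[OF assms(2), of "-1"]] by simp

lemma geom_bounded_sum:
  "(\<And>i. i \<in> I \<Longrightarrow> geom_bounded (a i)) \<Longrightarrow> geom_bounded (\<lambda>k. \<Sum>i\<in>I. a i k)"
  by (induction I rule: infinite_finite_induct) (auto intro: geom_bounded_zero geom_bounded_add)

lemma geom_bounded_Suc:
  assumes "geom_bounded a" shows "geom_bounded (\<lambda>k. a (Suc k))"
proof -
  obtain C R where C: "0 \<le> C" and a: "1 \<le> R" "\<And>k. cmod (a k) \<le> C * R ^ k"
    using geom_boundedE[OF assms] by blast
  show ?thesis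
  proof (rule geom_boundedI[of _ "C * R" R])
    show "cmod (a (Suc k)) \<le> C * R * R ^ k" for k
      using a(2)[of "Suc k"] by (simp add: mult.assoc)
  qed (rule a)
qed

lemma geom_bounded_delay:
  assumes "geom_bounded a" shows "geom_bounded (\<lambda>k. if k < p then 0 else a (k - p))"
proof -
  obtain C R where C: "0 \<le> C" and a: "1 \<le> R" "\<And>k. cmod (a k) \<le> C * R ^ k"
    using geom_boundedE[OF assms] by blast
  show ?thesis
  proof (rule geom_boundedI[of _ C R])
    fix k
    have "C * R ^ (k - p) \<le> C * R ^ k"
      using a(1) C by (intro mult_left_mono power_increasing) auto
    then show "cmod (if k < p then 0 else a (k - p)) \<le> C * R ^ k"
      using order_trans[OF a(2)[of "k - p"]] C a(1) by simp
  qed (rule a)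
qed

lemma egf_summable:
  assumes "geom_bounded a"
  shows "summable (\<lambda>k. norm (a k * z ^ k / fact (k + p)))"
proof -
  obtain C R where C: "0 \<le> C" and a: "1 \<le> R" "\<And>k. cmod (a k) \<le> C * R ^ k"
    using geom_boundedE[OF assms] by blast
  show ?thesis
  proof (rule summable_comparison_test'[of "\<lambda>k. C * ((R * cmod z) ^ k /\<^sub>R fact k)"])
    show "summable (\<lambda>k. C * ((R * cmod z) ^ k /\<^sub>R fact k))"
      by (intro summable_mult summable_exp_generic)
    fix k :: nat
    have "norm (a k * z ^ k / fact (k + p)) = cmod (a k) * cmod z ^ k / fact (k + p)"
      by (simp add: norm_mult norm_divide norm_power)
    also have "\<dots> \<le> (C * R ^ k) * cmod z ^ k / fact k"
      using a C by (intro frac_le mult_right_mono fact_mono) auto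
    finally show "norm (norm (a k * z ^ k / fact (k + p))) \<le> C * ((R * cmod z) ^ k /\<^sub>R fact k)"
      by (simp add: power_mult_distrib field_simps)
  qed
qed

lemma egf_summable0:
  assumes "geom_bounded a" shows "summable (\<lambda>k. a k * z ^ k / fact k)"
  using summable_norm_cancel[OF egf_summable[OF assms, of z 0]] by simp

lemma egf_0: "egf a 0 = a 0"
  unfolding egf_def using suminf_finite[of "{0}" "\<lambda>k. a k * of_real 0 ^ k / fact k"] by simp

lemma egf_zero [simp]: "egf (\<lambda>k. 0) t = 0"
  by (simp add: egf_def)

lemma egf_add:
  "geom_bounded a \<Longrightarrow> geom_bounded b \<Longrightarrow> egf (\<lambda>k. a k + b k) t = egf a t + egf b t"
  unfolding egf_def by (subst suminf_add) (auto intro: egf_summable0 simp: ring_distribs add_divide_distrib)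

lemma egf_cmult: "geom_bounded a \<Longrightarrow> egf (\<lambda>k. c * a k) t = c * egf a t"
  unfolding egf_def by (subst suminf_mult[symmetric]) (auto intro: egf_summable0 simp: mult.assoc)

lemma egf_sum:
  "(\<And>i. i \<in> I \<Longrightarrow> geom_bounded (a i)) \<Longrightarrow> egf (\<lambda>k. \<Sum>i\<in>I. a i k) t = (\<Sum>i\<in>I. egf (a i) t)"
  by (induction I rule: infinite_finite_induct) (auto simp: egf_add geom_bounded_sum)

text \<open>Differentiation of an exponential generating function is a shift of its sequence. Hence a recurrence
for the coefficients is the same thing as a differential equation, and no matrix exponential has to
be differentiated.\<close>

lemma egf_deriv:
  assumes "geom_bounded a"
  shows "(egf a has_vector_derivative egf (\<lambda>k. a (Suc k)) t) (at t)"
proof -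
  define c where "c k = a k / fact k" for k
  have s: "summable (\<lambda>k. c k * z ^ k)" for z
    using egf_summable0[OF assms, of z] by (simp add: c_def)
  have d: "diffs c k = a (Suc k) / fact k" for k
    by (simp add: diffs_def c_def field_simps del: of_nat_Suc)
  have "((\<lambda>z. \<Sum>k. c k * z ^ k) has_field_derivative (\<Sum>k. diffs c k * of_real t ^ k)) (at (of_real t))"
    by (rule termdiffs_strong_converges_everywhere[OF s])
  from has_vector_derivative_real_field[OF this]
  show ?thesis unfolding d by (simp add: egf_def[abs_def] c_def)
qed

section \<open>Linear recurrences with stable characteristic roots\<close>

text \<open>The sequence is killed by the product of the operators \<open>S - \<mu>\<close> with \<open>S\<close> the shift, that is, it
satisfies the linear recurrence with characteristic roots \<open>\<mu>s\<close>.\<close>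

fun annihilated :: "complex list \<Rightarrow> (nat \<Rightarrow> complex) \<Rightarrow> bool" where
  "annihilated [] a \<longleftrightarrow> (\<forall>k. a k = 0)"
| "annihilated (\<mu> # \<mu>s) a \<longleftrightarrow> annihilated \<mu>s (\<lambda>k. a (Suc k) - \<mu> * a k)"

lemma annihilated_zero: "annihilated \<mu>s (\<lambda>k. 0)"
  by (induction \<mu>s) auto

lemma annihilated_add:
  "annihilated \<mu>s a \<Longrightarrow> annihilated \<mu>s b \<Longrightarrow> annihilated \<mu>s (\<lambda>k. a k + b k)"
proof (induction \<mu>s arbitrary: a b)
  case (Cons \<mu> \<mu>s)
  from Cons.IH[of "\<lambda>k. a (Suc k) - \<mu> * a k" "\<lambda>k. b (Suc k) - \<mu> * b k"] Cons.prems
  show ?case by (simp add: algebra_simps)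
qed auto

lemma annihilated_cmult:
  "annihilated \<mu>s a \<Longrightarrow> annihilated \<mu>s (\<lambda>k. c * a k)"
proof (induction \<mu>s arbitrary: a)
  case (Cons \<mu> \<mu>s)
  from Cons.IH[of "\<lambda>k. a (Suc k) - \<mu> * a k"] Cons.prems
  show ?case by (simp add: algebra_simps)
qed auto

lemma annihilated_sum:
  "(\<And>i. i \<in> I \<Longrightarrow> annihilated \<mu>s (a i)) \<Longrightarrow> annihilated \<mu>s (\<lambda>k. \<Sum>i\<in>I. a i k)"
  by (induction I rule: infinite_finite_induct) (auto intro: annihilated_zero annihilated_add)

lemma annihilated_Suc: "annihilated \<mu>s a \<Longrightarrow> annihilated \<mu>s (\<lambda>k. a (Suc k))"
  by (induction \<mu>s arbitrary: a) auto

lemma annihilated_Cons: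
  assumes "annihilated \<mu>s a" shows "annihilated (\<mu> # \<mu>s) a"
  using annihilated_add[OF annihilated_Suc[OF assms] annihilated_cmult[OF assms, of "-\<mu>"]]
  by simp

lemma annihilated_append: "annihilated \<mu>s a \<Longrightarrow> annihilated (\<nu>s @ \<mu>s) a"
  by (induction \<nu>s) (simp_all add: annihilated_Cons del: annihilated.simps(2))

lemma has_real_derivative_power_div_fact:
  "((\<lambda>s. c * s ^ Suc d / fact (Suc d)) has_real_derivative c * s ^ d / fact d) (at s)"
proof -
  have "((\<lambda>s. c / fact (Suc d) * s ^ Suc d) has_real_derivative
      c / fact (Suc d) * (real (Suc d) * s ^ d)) (at s)"
    using DERIV_cmult[OF DERIV_pow[of "Suc d" s UNIV], of "c / fact (Suc d)"] by simp
  moreover have "c / fact (Suc d) * (real (Suc d) * s ^ d) = c * s ^ d / fact d"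
    by (simp add: field_simps del: of_nat_Suc)
  ultimately show ?thesis by simp
qed

text \<open>The function \<open>f = egf a\<close> solves \<open>\<Prod>(d/dt - \<mu>\<^sub>i) f = 0\<close> with vanishing initial data below order \<open>d\<close>, so
it is \<open>a\<^sub>d\<close> times the divided difference of \<open>\<mu> \<mapsto> exp(t \<mu>)\<close> at the roots, whose modulus is at most
\<open>t\<^sup>d / d!\<close> when the roots lie in the left half-plane. Splitting off one factor \<open>d/dt - \<mu>\<close> at a time
proves this without divided differences: each step is a scalar equation \<open>f' = \<mu> f + g\<close> with
\<open>Re \<mu> \<le> 0\<close> and \<open>g\<close> bounded by induction.\<close>

lemma egf_stable_recurrence_bound:
  assumes "annihilated \<mu>s a" "length \<mu>s = Suc d" "geom_bounded a"
    and "\<And>\<mu>. \<mu> \<in> set \<mu>s \<Longrightarrow> Re \<mu> \<le> 0"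
    and "\<And>k. k < d \<Longrightarrow> a k = 0" and "0 \<le> t"
  shows "cmod (egf a t) \<le> cmod (a d) * t ^ d / fact d"
  using assms
proof (induction \<mu>s arbitrary: a d t)
  case (Cons \<mu> \<mu>s)
  define b where "b k = a (Suc k) - \<mu> * a k" for k
  have ann: "annihilated \<mu>s b" using Cons.prems unfolding b_def by simp
  have eb: "geom_bounded b" unfolding b_def
    using Cons.prems by (intro geom_bounded_diff geom_bounded_Suc geom_bounded_cmult)
  have Re\<mu>: "Re \<mu> \<le> 0" using Cons.prems by simp
  have sh: "(\<lambda>k. a (Suc k)) = (\<lambda>k. \<mu> * a k + b k)" by (simp add: b_def)
  have deriv: "(egf a has_vector_derivative \<mu> * egf a s + egf b s) (at s)" for s
    using egf_deriv[OF Cons.prems(3), of s] unfolding sh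
    by (simp add: egf_add egf_cmult geom_bounded_cmult Cons.prems(3) eb)
  have diss: "Re (cnj (egf a s) * (\<mu> * egf a s + egf b s)) \<le> cmod (egf a s) * g"
    if "cmod (egf b s) \<le> g" for s g
  proof -
    have "Re (cnj (egf a s) * (\<mu> * egf a s)) = Re \<mu> * (cmod (egf a s))\<^sup>2"
      unfolding cmod_power2 by (simp add: algebra_simps power2_eq_square)
    also have "\<dots> \<le> 0" using Re\<mu> by (simp add: mult_nonpos_nonneg)
    finally have 1: "Re (cnj (egf a s) * (\<mu> * egf a s)) \<le> 0" .
    have "Re (cnj (egf a s) * egf b s) \<le> cmod (cnj (egf a s) * egf b s)"
      by (rule complex_Re_le_cmod)
    also have "\<dots> \<le> cmod (egf a s) * g"
      using that by (simp add: norm_mult mult_left_mono)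
    finally show ?thesis using 1 by (simp only: ring_distribs plus_complex.sel)
  qed
  show ?case
  proof (cases d)
    case 0
    then have "\<mu>s = []" using Cons.prems by simp
    then have b0: "b = (\<lambda>k. 0)" using ann by auto
    \<comment> \<open>A scalar equation is a family indexed by a singleton.\<close>
    have "L2_set (\<lambda>i::nat. cmod (egf a t)) {0}
        \<le> L2_set (\<lambda>i::nat. cmod (egf a 0)) {0} + 0 - 0"
    proof (rule L2_growth_bound[where y = "\<lambda>_. egf a" and
          y' = "\<lambda>_ s. \<mu> * egf a s + egf b s" and b = "\<lambda>_. 0" and b' = "\<lambda>_. 0"])
      fix s :: real
      show "Re (\<Sum>i\<in>{0::nat}. cnj (egf a s) * (\<mu> * egf a s + egf b s))
          \<le> L2_set (\<lambda>i. cmod (egf a s)) {0::nat} * 0"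
        using diss[of s 0] by (simp add: b0)
    qed (use deriv Cons.prems in simp_all)
    then show ?thesis using 0 by (simp add: egf_0)
  next
    case (Suc d')
    have b0: "b k = 0" if "k < d'" for k using that Suc Cons.prems(5) by (simp add: b_def)
    have bd: "b d' = a d" using Suc Cons.prems(5)[of d'] by (simp add: b_def)
    have IH: "cmod (egf b s) \<le> cmod (a d) * s ^ d' / fact d'" if "0 \<le> s" for s
      using Cons.IH[OF ann _ eb _ b0 that] Cons.prems(2,4) Suc bd by simp
    have "L2_set (\<lambda>i::nat. cmod (egf a t)) {0}
        \<le> L2_set (\<lambda>i::nat. cmod (egf a 0)) {0} + cmod (a d) * t ^ d / fact d - cmod (a d) * 0 ^ d / fact d"
    proof (rule L2_growth_bound[where y = "\<lambda>_. egf a" and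
          y' = "\<lambda>_ s. \<mu> * egf a s + egf b s" and b = "\<lambda>s. cmod (a d) * s ^ d / fact d"
          and b' = "\<lambda>s. cmod (a d) * s ^ d' / fact d'"])
      fix s :: real assume s: "0 \<le> s"
      show "((\<lambda>s. cmod (a d) * s ^ d / fact d) has_real_derivative cmod (a d) * s ^ d' / fact d') (at s)"
        unfolding Suc by (rule has_real_derivative_power_div_fact)
      show "Re (\<Sum>i\<in>{0::nat}. cnj (egf a s) * (\<mu> * egf a s + egf b s))
          \<le> L2_set (\<lambda>i. cmod (egf a s)) {0::nat} * (cmod (a d) * s ^ d' / fact d')"
        using diss[OF IH[OF s]] by simp
      show "0 \<le> cmod (a d) * s ^ d' / fact d'" using s by simp
    qed (use deriv Cons.prems in simp_all)
    then show ?thesis using Cons.prems(5)[of 0] Suc by (simp add: egf_0)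
  qed
qed simp

section \<open>Matrices acting on vectors\<close>

lemma mult_mat_vec_entry:
  assumes "A \<in> carrier_mat n m" "x \<in> carrier_vec m" "i < n"
  shows "(A *\<^sub>v x) $ i = (\<Sum>j<m. A $$ (i, j) * x $ j)"
  using assms by (auto simp: scalar_prod_def atLeast0LessThan intro!: sum.cong)

lemma mult_mat_unit_vec:
  fixes A :: "complex mat"
  assumes "A \<in> carrier_mat n m" "i < n" "j < m"
  shows "(A *\<^sub>v unit_vec m j) $ i = A $$ (i, j)"
proof -
  have "(A *\<^sub>v unit_vec m j) $ i = (\<Sum>l<m. A $$ (i, l) * unit_vec m j $ l)"
    by (rule mult_mat_vec_entry[OF assms(1) _ assms(2)]) simp
  also have "\<dots> = (\<Sum>l<m. if l = j then A $$ (i, j) else 0)"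
    by (rule sum.cong) (use assms in auto)
  finally show ?thesis using assms by simp
qed

lemma power_Suc_mult_vec:
  fixes A :: "complex mat"
  assumes A: "A \<in> carrier_mat n n" and x: "x \<in> carrier_vec n"
  shows "(A ^\<^sub>m Suc k) *\<^sub>v x = A *\<^sub>v ((A ^\<^sub>m k) *\<^sub>v x)"
  using x
proof (induction k arbitrary: x)
  case (Suc k)
  have "(A ^\<^sub>m Suc (Suc k)) *\<^sub>v x = (A ^\<^sub>m Suc k) *\<^sub>v (A *\<^sub>v x)"
    unfolding pow_mat.simps(2)[of A "Suc k"]
    by (rule assoc_mult_mat_vec[OF pow_carrier_mat[OF A] A Suc.prems])
  also have "\<dots> = A *\<^sub>v ((A ^\<^sub>m k) *\<^sub>v (A *\<^sub>v x))"
    by (rule Suc.IH) (use A Suc.prems in simp)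
  also have "(A ^\<^sub>m k) *\<^sub>v (A *\<^sub>v x) = (A ^\<^sub>m Suc k) *\<^sub>v x"
    using assoc_mult_mat_vec[OF pow_carrier_mat[OF A] A Suc.prems] by simp
  finally show ?case .
qed (use A in simp)

lemma smult_mat_mult_vec:
  fixes A :: "complex mat"
  assumes A: "A \<in> carrier_mat n m" and x: "x \<in> carrier_vec m"
  shows "(c \<cdot>\<^sub>m A) *\<^sub>v x = c \<cdot>\<^sub>v (A *\<^sub>v x)"
proof (rule eq_vecI)
  fix i assume "i < dim_vec (c \<cdot>\<^sub>v (A *\<^sub>v x))"
  then have i: "i < n" using A by simp
  have "(c \<cdot>\<^sub>m A) \<in> carrier_mat n m" using A by simp
  from mult_mat_vec_entry[OF this x i] mult_mat_vec_entry[OF A x i]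
  show "((c \<cdot>\<^sub>m A) *\<^sub>v x) $ i = (c \<cdot>\<^sub>v (A *\<^sub>v x)) $ i"
    using A i by (auto simp: sum_distrib_left mult.assoc simp del: index_mult_mat_vec intro!: sum.cong)
qed (use A in simp)

lemma power_smult_mult_vec:
  fixes A :: "complex mat"
  assumes A: "A \<in> carrier_mat n n" and x: "x \<in> carrier_vec n"
  shows "((c \<cdot>\<^sub>m A) ^\<^sub>m k) *\<^sub>v x = c ^ k \<cdot>\<^sub>v ((A ^\<^sub>m k) *\<^sub>v x)"
proof (induction k)
  case (Suc k)
  have y: "(A ^\<^sub>m k) *\<^sub>v x \<in> carrier_vec n"
    using A x by (meson mult_mat_vec_carrier pow_carrier_mat)
  have cA: "c \<cdot>\<^sub>m A \<in> carrier_mat n n" using A by simp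
  have "((c \<cdot>\<^sub>m A) ^\<^sub>m Suc k) *\<^sub>v x = (c \<cdot>\<^sub>m A) *\<^sub>v (c ^ k \<cdot>\<^sub>v ((A ^\<^sub>m k) *\<^sub>v x))"
    unfolding power_Suc_mult_vec[OF cA x] Suc ..
  also have "\<dots> = c ^ k \<cdot>\<^sub>v (c \<cdot>\<^sub>v (A *\<^sub>v ((A ^\<^sub>m k) *\<^sub>v x)))"
    unfolding mult_mat_vec[OF cA y] smult_mat_mult_vec[OF A y] ..
  also have "\<dots> = c ^ Suc k \<cdot>\<^sub>v ((A ^\<^sub>m Suc k) *\<^sub>v x)"
    unfolding power_Suc_mult_vec[OF A x] by (simp add: smult_smult_assoc mult.commute)
  finally show ?case .
qed (use A x in simp)

lemma L2_set_cmod_triangle: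
  "L2_set (\<lambda>i. cmod (x i + y i)) I \<le> L2_set (\<lambda>i. cmod (x i)) I + L2_set (\<lambda>i. cmod (y i)) I"
proof -
  have "L2_set (\<lambda>i. cmod (x i + y i)) I \<le> L2_set (\<lambda>i. cmod (x i) + cmod (y i)) I"
    by (rule L2_set_mono) (auto intro: norm_triangle_ineq)
  also have "\<dots> \<le> L2_set (\<lambda>i. cmod (x i)) I + L2_set (\<lambda>i. cmod (y i)) I"
    by (rule L2_set_triangle_ineq)
  finally show ?thesis .
qed

lemma L2_set_cmod_cmult:
  "L2_set (\<lambda>i. cmod (c * x i)) I = cmod c * L2_set (\<lambda>i. cmod (x i)) I"
  by (simp add: norm_mult L2_set_right_distrib)

lemma vec_norm2_carrier: "x \<in> carrier_vec n \<Longrightarrow> vec_norm2 x = L2_set (\<lambda>i. cmod (x $ i)) {..<n}"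
  by (simp add: vec_norm2_def)

lemma vec_norm2_nonneg: "0 \<le> vec_norm2 x"
  by (simp add: vec_norm2_def)

lemma vec_norm2_smult: "vec_norm2 (c \<cdot>\<^sub>v x) = cmod c * vec_norm2 x"
proof -
  have "vec_norm2 (c \<cdot>\<^sub>v x) = L2_set (\<lambda>i. cmod (c * x $ i)) {..<dim_vec x}"
    unfolding vec_norm2_def by (rule L2_set_cong) auto
  then show ?thesis by (simp add: L2_set_cmod_cmult vec_norm2_def)
qed

lemma vec_norm2_triangle:
  assumes "x \<in> carrier_vec n" "y \<in> carrier_vec n"
  shows "vec_norm2 (x + y) \<le> vec_norm2 x + vec_norm2 y"
proof -
  have "vec_norm2 (x + y) = L2_set (\<lambda>i. cmod (x $ i + y $ i)) {..<n}"
    unfolding vec_norm2_def by (rule L2_set_cong) (use assms in auto)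
  then show ?thesis using L2_set_cmod_triangle assms by (simp add: vec_norm2_carrier)
qed

text \<open>The crude constant, a sum over all entries, suffices: it is only used to know that suprema and
power series exist.\<close>

lemma mult_mat_vec_bounded:
  assumes A: "A \<in> carrier_mat n n"
  obtains C where "1 \<le> C" "\<And>x. x \<in> carrier_vec n \<Longrightarrow> vec_norm2 (A *\<^sub>v x) \<le> C * vec_norm2 x"
proof
  let ?C = "\<Sum>i<n. \<Sum>j<n. cmod (A $$ (i, j))"
  show "1 \<le> 1 + ?C" by (simp add: sum_nonneg)
  fix x :: "complex vec" assume x: "x \<in> carrier_vec n"
  have "vec_norm2 (A *\<^sub>v x) \<le> (\<Sum>i<n. cmod ((A *\<^sub>v x) $ i))"
    using A by (simp add: vec_norm2_def L2_set_le_sum del: index_mult_mat_vec)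
  also have "\<dots> \<le> (\<Sum>i<n. (\<Sum>j<n. cmod (A $$ (i, j))) * vec_norm2 x)"
  proof (rule sum_mono)
    fix i assume "i \<in> {..<n}"
    then have i: "i < n" by simp
    have "cmod ((A *\<^sub>v x) $ i) \<le> (\<Sum>j<n. cmod (A $$ (i, j) * x $ j))"
      unfolding mult_mat_vec_entry[OF A x i] by (rule norm_sum)
    also have "\<dots> \<le> (\<Sum>j<n. cmod (A $$ (i, j)) * vec_norm2 x)"
      unfolding norm_mult vec_norm2_carrier[OF x]
      by (intro sum_mono mult_left_mono member_le_L2_set) auto
    finally show "cmod ((A *\<^sub>v x) $ i) \<le> (\<Sum>j<n. cmod (A $$ (i, j))) * vec_norm2 x"
      by (simp add: sum_distrib_right)
  qed
  also have "\<dots> \<le> (1 + ?C) * vec_norm2 x"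
    by (simp add: sum_distrib_right[symmetric] distrib_right vec_norm2_nonneg)
  finally show "vec_norm2 (A *\<^sub>v x) \<le> (1 + ?C) * vec_norm2 x" .
qed

lemma power_mult_vec_carrier:
  "A \<in> carrier_mat n n \<Longrightarrow> x \<in> carrier_vec n \<Longrightarrow> (A ^\<^sub>m k) *\<^sub>v x \<in> carrier_vec n"
  by (meson mult_mat_vec_carrier pow_carrier_mat)

lemma power_mult_vec_geom_bounded:
  assumes A: "A \<in> carrier_mat n n" and x: "x \<in> carrier_vec n" and i: "i < n"
  shows "geom_bounded (\<lambda>k. ((A ^\<^sub>m k) *\<^sub>v x) $ i)"
proof -
  obtain C where C: "1 \<le> C" "\<And>x. x \<in> carrier_vec n \<Longrightarrow> vec_norm2 (A *\<^sub>v x) \<le> C * vec_norm2 x"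
    using mult_mat_vec_bounded[OF A] by blast
  note car = power_mult_vec_carrier[OF A x]
  have "vec_norm2 ((A ^\<^sub>m k) *\<^sub>v x) \<le> vec_norm2 x * C ^ k" for k
  proof (induction k)
    case (Suc k)
    have "vec_norm2 ((A ^\<^sub>m Suc k) *\<^sub>v x) \<le> C * vec_norm2 ((A ^\<^sub>m k) *\<^sub>v x)"
      unfolding power_Suc_mult_vec[OF A x] by (rule C(2)[OF car])
    also have "\<dots> \<le> C * (vec_norm2 x * C ^ k)"
      using Suc C(1) by (intro mult_left_mono) auto
    finally show ?case by (simp add: mult_ac)
  qed (use A x in simp)
  moreover have "cmod (((A ^\<^sub>m k) *\<^sub>v x) $ i) \<le> vec_norm2 ((A ^\<^sub>m k) *\<^sub>v x)" for k
    unfolding vec_norm2_carrier[OF car] by (intro member_le_L2_set) (use i in auto)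
  ultimately show ?thesis
    using C(1) by (intro geom_boundedI[of _ "vec_norm2 x" C]) (auto intro: order_trans)
qed

section \<open>The logarithmic norm and the field of values\<close>

lemma mat_norm2_upper:
  assumes A: "A \<in> carrier_mat n n" and x: "x \<in> carrier_vec n" "vec_norm2 x = 1"
  shows "vec_norm2 (A *\<^sub>v x) \<le> mat_norm2 A"
proof -
  obtain C where C: "1 \<le> C" "\<And>x. x \<in> carrier_vec n \<Longrightarrow> vec_norm2 (A *\<^sub>v x) \<le> C * vec_norm2 x"
    using mult_mat_vec_bounded[OF A] by blast
  have "bdd_above ((\<lambda>x. vec_norm2 (A *\<^sub>v x)) ` {x \<in> carrier_vec n. vec_norm2 x = 1})"
    by (rule bdd_aboveI[of _ C]) (use C(2) in force)
  then show ?thesis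
    unfolding mat_norm2_def using A x by (intro cSUP_upper) auto
qed

text \<open>The quotients \<open>(\<parallel>I + h A\<parallel> - 1) / h\<close> are nondecreasing in \<open>h > 0\<close> by convexity of the norm, and
\<open>1 + h Re (x\<^sup>* A x) = Re (x\<^sup>* (I + h A) x) \<le> \<parallel>I + h A\<parallel>\<close> shows that each of them is at least
\<open>Re (x\<^sup>* A x)\<close>. So the limit defining the logarithmic norm exists, equals the infimum of the
quotients, and inherits this lower bound.\<close>

lemma Re_field_of_values_le_log_norm2:
  assumes A: "A \<in> carrier_mat n n" and x: "x \<in> carrier_vec n" "vec_norm2 x = 1"
  shows "Re (\<Sum>i<n. cnj (x $ i) * (A *\<^sub>v x) $ i) \<le> log_norm2 A"
proof -
  define B where "B h = 1\<^sub>m n + complex_of_real h \<cdot>\<^sub>m A" for h :: real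
  define q where "q h = (mat_norm2 (B h) - 1) / h" for h
  define \<rho> where "\<rho> = Re (\<Sum>i<n. cnj (x $ i) * (A *\<^sub>v x) $ i)"
  have B: "B h \<in> carrier_mat n n" for h unfolding B_def using A by simp
  have Bv: "B h *\<^sub>v y = y + complex_of_real h \<cdot>\<^sub>v (A *\<^sub>v y)" if y: "y \<in> carrier_vec n" for h y
    unfolding B_def using A y
    by (subst add_mult_distrib_mat_vec[of _ n n]) (auto simp: smult_mat_mult_vec[OF A y])
  have lower: "\<rho> \<le> q h" if h: "0 < h" for h
  proof -
    have "1 + h * \<rho> = Re (\<Sum>i<n. cnj (x $ i) * (B h *\<^sub>v x) $ i)"
    proof -
      have "(\<Sum>i<n. cnj (x $ i) * (B h *\<^sub>v x) $ i) =
          (\<Sum>i<n. complex_of_real ((cmod (x $ i))\<^sup>2)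
            + complex_of_real h * (cnj (x $ i) * (A *\<^sub>v x) $ i))"
      proof (rule sum.cong[OF refl])
        fix i assume i: "i \<in> {..<n}"
        have "(B h *\<^sub>v x) $ i = x $ i + complex_of_real h * (A *\<^sub>v x) $ i"
          unfolding Bv[OF x(1)] using i A x(1) by (simp del: index_mult_mat_vec)
        then show "cnj (x $ i) * (B h *\<^sub>v x) $ i = complex_of_real ((cmod (x $ i))\<^sup>2)
            + complex_of_real h * (cnj (x $ i) * (A *\<^sub>v x) $ i)"
          by (simp only: complex_norm_square) (simp add: algebra_simps)
      qed
      also have "\<dots> = complex_of_real ((vec_norm2 x)\<^sup>2)
          + complex_of_real h * (\<Sum>i<n. cnj (x $ i) * (A *\<^sub>v x) $ i)"
        unfolding vec_norm2_carrier[OF x(1)] L2_set_sq sum.distrib sum_distrib_left of_real_sum ..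
      finally show ?thesis unfolding \<rho>_def x(2) by simp
    qed
    also have "\<dots> \<le> cmod (\<Sum>i<n. cnj (x $ i) * (B h *\<^sub>v x) $ i)" by (rule complex_Re_le_cmod)
    also have "\<dots> \<le> vec_norm2 x * vec_norm2 (B h *\<^sub>v x)"
      unfolding vec_norm2_carrier[OF x(1)] vec_norm2_carrier[OF mult_mat_vec_carrier[OF B x(1)]]
      by (rule cmod_sum_cnj_mult_le)
    also have "\<dots> \<le> mat_norm2 (B h)" using mat_norm2_upper[OF B x] x by simp
    finally show ?thesis unfolding q_def using h by (simp add: field_simps)
  qed
  have mono: "q h \<le> q k" if h: "0 < h" "h \<le> k" for h k
  proof -
    have "mat_norm2 (B h) \<le> (1 - h / k) + h / k * mat_norm2 (B k)"
      unfolding mat_norm2_def[of "B h"]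
    proof (rule cSUP_least)
      show "{x \<in> carrier_vec (dim_col (B h)). vec_norm2 x = 1} \<noteq> {}" using x B[of h] by auto
      fix y assume "y \<in> {x \<in> carrier_vec (dim_col (B h)). vec_norm2 x = 1}"
      then have y: "y \<in> carrier_vec n" "vec_norm2 y = 1" using B[of h] by auto
      \<comment> \<open>\<open>I + h A\<close> is the convex combination of \<open>I\<close> and \<open>I + k A\<close> with weight \<open>h / k\<close>.\<close>
      have "B h *\<^sub>v y = complex_of_real (1 - h / k) \<cdot>\<^sub>v y + complex_of_real (h / k) \<cdot>\<^sub>v (B k *\<^sub>v y)"
        unfolding Bv[OF y(1)] using A y h
        by (intro eq_vecI) (auto simp: field_simps simp del: index_mult_mat_vec)
      then have "vec_norm2 (B h *\<^sub>v y) \<le>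
          vec_norm2 (complex_of_real (1 - h / k) \<cdot>\<^sub>v y) + vec_norm2 (complex_of_real (h / k) \<cdot>\<^sub>v (B k *\<^sub>v y))"
        using vec_norm2_triangle[of "complex_of_real (1 - h / k) \<cdot>\<^sub>v y" n "complex_of_real (h / k) \<cdot>\<^sub>v (B k *\<^sub>v y)"]
          y mult_mat_vec_carrier[OF B[of k] y(1)] by simp
      also have "\<dots> = (1 - h / k) + h / k * vec_norm2 (B k *\<^sub>v y)"
        unfolding vec_norm2_smult norm_of_real y(2) using h by simp
      also have "\<dots> \<le> (1 - h / k) + h / k * mat_norm2 (B k)"
        using mat_norm2_upper[OF B y, of k] h by (intro add_left_mono mult_left_mono) auto
      finally show "vec_norm2 (B h *\<^sub>v y) \<le> (1 - h / k) + h / k * mat_norm2 (B k)" .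
    qed
    then have "mat_norm2 (B h) - 1 \<le> h / k * (mat_norm2 (B k) - 1)" by (simp add: algebra_simps)
    then show ?thesis unfolding q_def using h by (simp add: field_simps)
  qed
  define L where "L = (INF h\<in>{0<..}. q h)"
  have bdd: "bdd_below (q ` {0<..})" using lower by (intro bdd_belowI[of _ \<rho>]) auto
  have "(q \<longlongrightarrow> L) (at_right 0)"
  proof (rule order_tendstoI)
    fix a assume a: "a < L"
    have "eventually (\<lambda>h::real. 0 < h) (at_right 0)" by (rule eventually_at_right_less)
    then show "eventually (\<lambda>h. a < q h) (at_right 0)"
    proof eventually_elim
      case (elim h)
      then have "L \<le> q h" unfolding L_def by (intro cINF_lower bdd) auto
      then show ?case using a by simp
    qed
  next
    fix a assume a: "L < a"
    then obtain k where k: "0 < k" "q k < a"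
      unfolding L_def using cINF_less_iff[OF _ bdd, of a] by auto
    have "eventually (\<lambda>h. h \<in> {0<..<k}) (at_right 0)" using k(1) by (rule eventually_at_right_real)
    then show "eventually (\<lambda>h. q h < a) (at_right 0)"
    proof eventually_elim
      case (elim h)
      then show ?case using mono[of h k] k by simp
    qed
  qed
  then have "Lim (at_right 0) q = L" by (rule tendsto_Lim[rotated]) simp
  then have "log_norm2 A = L" using A by (simp add: log_norm2_def q_def[abs_def] B_def)
  moreover have "\<rho> \<le> L" unfolding L_def by (rule cINF_greatest) (use lower in auto)
  ultimately show ?thesis by (simp add: \<rho>_def)
qed

lemma dissipative_of_log_norm2_nonpos:
  assumes A: "A \<in> carrier_mat n n" and le: "log_norm2 A \<le> 0" and x: "x \<in> carrier_vec n"
  shows "Re (\<Sum>i<n. cnj (x $ i) * (A *\<^sub>v x) $ i) \<le> 0"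
proof (cases "vec_norm2 x = 0")
  case True
  then have "x $ i = 0" if "i < n" for i
    using that unfolding vec_norm2_carrier[OF x] by (simp add: L2_set_eq_0_iff)
  then show ?thesis by simp
next
  case False
  define r where "r = vec_norm2 x"
  have r: "0 < r" using False vec_norm2_nonneg[of x] by (simp add: r_def)
  define y where "y = complex_of_real (1 / r) \<cdot>\<^sub>v x"
  have y: "y \<in> carrier_vec n" "vec_norm2 y = 1"
    using x r unfolding y_def vec_norm2_smult norm_of_real by (simp_all add: r_def)
  have "(\<Sum>i<n. cnj (y $ i) * (A *\<^sub>v y) $ i) =
      complex_of_real (1 / r\<^sup>2) * (\<Sum>i<n. cnj (x $ i) * (A *\<^sub>v x) $ i)"
    unfolding sum_distrib_left
  proof (rule sum.cong[OF refl])
    fix i assume "i \<in> {..<n}"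
    then show "cnj (y $ i) * (A *\<^sub>v y) $ i =
        complex_of_real (1 / r\<^sup>2) * (cnj (x $ i) * (A *\<^sub>v x) $ i)"
      unfolding y_def mult_mat_vec[OF A x] using A x
      by (simp add: power2_eq_square del: index_mult_mat_vec)
  qed
  then have "1 / r\<^sup>2 * Re (\<Sum>i<n. cnj (x $ i) * (A *\<^sub>v x) $ i) \<le> 0"
    using Re_field_of_values_le_log_norm2[OF A y] le by (simp only: Re_complex_of_real times_complex.sel Im_complex_of_real)
  then show ?thesis using r by (simp add: field_simps)
qed

section \<open>Powers of a matrix as solutions of a linear recurrence\<close>

text \<open>This is the Cayley--Hamilton theorem read off a Schur form \<open>T = P B Q\<close>. The last component of
\<open>u\<^sub>k = B\<^sup>k Q x\<close> satisfies a first-order recurrence with the last eigenvalue, and each earlier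
component one with its own diagonal entry, forced by the later components. So the component \<open>j\<close> is
annihilated by the eigenvalues from position \<open>j\<close> on, and all of them by the whole list.\<close>

lemma power_entries_annihilated:
  assumes T: "T \<in> carrier_mat m m"
  obtains \<mu>s where "length \<mu>s = m" "\<And>\<mu>. \<mu> \<in> set \<mu>s \<Longrightarrow> eigenvalue T \<mu>"
    "\<And>x i. x \<in> carrier_vec m \<Longrightarrow> i < m \<Longrightarrow> annihilated \<mu>s (\<lambda>k. ((T ^\<^sub>m k) *\<^sub>v x) $ i)"
proof -
  obtain \<mu>s where cp: "char_poly T = (\<Prod>a\<leftarrow>\<mu>s. [:- a, 1:])" and len: "length \<mu>s = m"
    using char_poly_factorized[OF T] by blast
  obtain B P Q where dec: "schur_decomposition T \<mu>s = (B, P, Q)"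
    by (cases "schur_decomposition T \<mu>s") auto
  from schur_decomposition[OF T cp dec]
  have wit: "similar_mat_wit T B P Q" and ut: "upper_triangular B" and diag: "diag_mat B = \<mu>s"
    by auto
  note w = similar_mat_witD2[OF T wit]
  have \<mu>: "B $$ (i, i) = \<mu>s ! i" if "i < m" for i
    using that diag w(5) by (auto simp: diag_mat_def)
  have "annihilated \<mu>s (\<lambda>k. ((T ^\<^sub>m k) *\<^sub>v x) $ i)" if x: "x \<in> carrier_vec m" and i: "i < m" for x i
  proof -
    define u where "u k = (B ^\<^sub>m k) *\<^sub>v (Q *\<^sub>v x)" for k
    have Qx: "Q *\<^sub>v x \<in> carrier_vec m" using w x by simp
    have u: "u k \<in> carrier_vec m" for k
      unfolding u_def by (rule power_mult_vec_carrier[OF w(5) Qx])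
    have uSuc: "u (Suc k) = B *\<^sub>v u k" for k
      unfolding u_def by (rule power_Suc_mult_vec[OF w(5) Qx])
    have tail: "annihilated (drop j \<mu>s) (\<lambda>k. u k $ j)" if "j < m" for j
      using that
    proof (induction "m - j" arbitrary: j rule: less_induct)
      case less
      have rec: "u (Suc k) $ j - \<mu>s ! j * u k $ j = (\<Sum>l\<in>{Suc j..<m}. B $$ (j, l) * u k $ l)" for k
      proof -
        have "u (Suc k) $ j = (\<Sum>l<m. B $$ (j, l) * u k $ l)"
          unfolding uSuc by (rule mult_mat_vec_entry[OF w(5) u less.prems])
        also have "\<dots> = (\<Sum>l\<in>{j..<m}. B $$ (j, l) * u k $ l)"
          using ut less.prems w(5) by (intro sum.mono_neutral_right) (auto simp: upper_triangular_def)
        also have "\<dots> = B $$ (j, j) * u k $ j + (\<Sum>l\<in>{Suc j..<m}. B $$ (j, l) * u k $ l)"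
          using less.prems by (rule sum.atLeast_Suc_lessThan)
        finally show ?thesis using \<mu>[OF less.prems] by simp
      qed
      have "annihilated (drop (Suc j) \<mu>s) (\<lambda>k. \<Sum>l\<in>{Suc j..<m}. B $$ (j, l) * u k $ l)"
      proof (intro annihilated_sum annihilated_cmult)
        fix l assume "l \<in> {Suc j..<m}"
        then have l: "Suc j \<le> l" "l < m" by auto
        have "drop (Suc j) \<mu>s = take (l - Suc j) (drop (Suc j) \<mu>s) @ drop l \<mu>s"
          using l append_take_drop_id[of "l - Suc j" "drop (Suc j) \<mu>s"] by simp
        moreover have "annihilated (drop l \<mu>s) (\<lambda>k. u k $ l)"
          by (rule less.hyps) (use l in auto)
        ultimately show "annihilated (drop (Suc j) \<mu>s) (\<lambda>k. u k $ l)"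
          by (metis annihilated_append)
      qed
      then show ?case
        using less.prems len by (simp add: Cons_nth_drop_Suc[symmetric] rec)
    qed
    have all: "annihilated \<mu>s (\<lambda>k. u k $ j)" if "j < m" for j
      using annihilated_append[OF tail[OF that], of "take j \<mu>s"] by simp
    have "((T ^\<^sub>m k) *\<^sub>v x) $ i = (\<Sum>j<m. P $$ (i, j) * u k $ j)" for k
    proof -
      have "(T ^\<^sub>m k) *\<^sub>v x = (P * B ^\<^sub>m k * Q) *\<^sub>v x" using similar_mat_wit_pow_id[OF wit] by simp
      also have "\<dots> = P *\<^sub>v u k"
        unfolding u_def
        using w x by (simp add: assoc_mult_mat_vec[of _ m m _ m])
      finally show ?thesis using mult_mat_vec_entry[OF w(6) u i] by simp
    qed
    then show ?thesis by (auto intro!: annihilated_sum annihilated_cmult all)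
  qed
  moreover have "eigenvalue T \<mu>" if "\<mu> \<in> set \<mu>s" for \<mu>
    unfolding eigenvalue_root_char_poly[OF T] cp using that
    by (induction \<mu>s) auto
  ultimately show thesis using that len by blast
qed

lemma eigenvalue_Re_nonpos:
  assumes N: "N \<in> carrier_mat m m"
    and diss: "\<And>x. x \<in> carrier_vec m \<Longrightarrow> Re (\<Sum>i<m. cnj (x $ i) * (N *\<^sub>v x) $ i) \<le> 0"
    and ev: "eigenvalue N \<mu>"
  shows "Re \<mu> \<le> 0"
proof -
  obtain x where x: "x \<in> carrier_vec m" "x \<noteq> 0\<^sub>v m" "N *\<^sub>v x = \<mu> \<cdot>\<^sub>v x"
    using ev N by (auto simp: eigenvalue_def eigenvector_def)
  have "(\<Sum>i<m. cnj (x $ i) * (N *\<^sub>v x) $ i) = \<mu> * complex_of_real (\<Sum>i<m. (cmod (x $ i))\<^sup>2)"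
    unfolding of_real_sum sum_distrib_left x(3)
  proof (rule sum.cong[OF refl])
    fix i assume "i \<in> {..<m}"
    then show "cnj (x $ i) * (\<mu> \<cdot>\<^sub>v x) $ i = \<mu> * complex_of_real ((cmod (x $ i))\<^sup>2)"
      using x(1) unfolding complex_norm_square by (simp add: mult_ac)
  qed
  then have "Re \<mu> * (\<Sum>i<m. (cmod (x $ i))\<^sup>2) \<le> 0"
    using diss[OF x(1)] by (simp only: times_complex.sel Re_complex_of_real Im_complex_of_real)
  moreover have "0 < (\<Sum>i<m. (cmod (x $ i))\<^sup>2)"
  proof -
    obtain i where i: "i < m" "x $ i \<noteq> 0" using x(1,2) by (auto simp: vec_eq_iff)
    have "0 < (cmod (x $ i))\<^sup>2" using i by simp
    also have "\<dots> \<le> (\<Sum>i<m. (cmod (x $ i))\<^sup>2)" by (rule member_le_sum) (use i in auto)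
    finally show ?thesis .
  qed
  ultimately show ?thesis by (simp add: mult_le_0_iff)
qed

text \<open>The form of the compression \<open>V\<^sup>* M V\<close> at \<open>y\<close> is the form of \<open>M\<close> at \<open>V y\<close>, so dissipativity passes
from \<open>M\<close> to the projected matrix.\<close>

lemma dissipative_compression:
  assumes M: "M \<in> carrier_mat n n" and V: "V \<in> carrier_mat n m"
    and diss: "\<And>x. x \<in> carrier_vec n \<Longrightarrow> Re (\<Sum>i<n. cnj (x $ i) * (M *\<^sub>v x) $ i) \<le> 0"
    and y: "y \<in> carrier_vec m"
  shows "Re (\<Sum>j<m. cnj (y $ j) * ((mat_adjoint V * M * V) *\<^sub>v y) $ j) \<le> 0"
proof -
  have Vy: "V *\<^sub>v y \<in> carrier_vec n" using V y by simp
  define z where "z = M *\<^sub>v (V *\<^sub>v y)"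
  have z: "z \<in> carrier_vec n" unfolding z_def using M Vy by simp
  have adj: "mat_adjoint V \<in> carrier_mat m n" using V by (auto simp: mat_adjoint_def)
  have adj_entry: "mat_adjoint V $$ (j, i) = cnj (V $$ (i, j))" if "j < m" "i < n" for i j
    using that V by (simp add: mat_adjoint_def mat_of_rows_def)
  have "(mat_adjoint V * M * V) *\<^sub>v y = mat_adjoint V *\<^sub>v z"
    unfolding z_def
    using assoc_mult_mat_vec[OF mult_carrier_mat[OF adj M] V y] assoc_mult_mat_vec[OF adj M Vy] by simp
  then have "(\<Sum>j<m. cnj (y $ j) * ((mat_adjoint V * M * V) *\<^sub>v y) $ j)
      = (\<Sum>j<m. cnj (y $ j) * (\<Sum>i<n. cnj (V $$ (i, j)) * z $ i))"
    using mult_mat_vec_entry[OF adj z] adj_entry by (auto intro!: sum.cong)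
  also have "\<dots> = (\<Sum>j<m. \<Sum>i<n. cnj (V $$ (i, j) * y $ j) * z $ i)"
    by (simp add: sum_distrib_left mult_ac)
  also have "\<dots> = (\<Sum>i<n. \<Sum>j<m. cnj (V $$ (i, j) * y $ j) * z $ i)" by (rule sum.swap)
  also have "\<dots> = (\<Sum>i<n. cnj ((V *\<^sub>v y) $ i) * z $ i)"
    using mult_mat_vec_entry[OF V y]
    by (auto simp: cnj_sum sum_distrib_right simp del: index_mult_mat_vec intro!: sum.cong)
  finally show ?thesis using diss[OF Vy] by (simp add: z_def)
qed

section \<open>Power series of the functions \<open>\<phi>\<^sub>p\<close>\<close>

definition phi_series :: "nat \<Rightarrow> (nat \<Rightarrow> complex) \<Rightarrow> complex \<Rightarrow> complex" where
  "phi_series p a z = (\<Sum>k. a k * z ^ k / fact (k + p))"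

lemma phi_summable: "geom_bounded a \<Longrightarrow> summable (\<lambda>k. a k * z ^ k / fact (k + p))"
  by (rule summable_norm_cancel[OF egf_summable])

lemma phi_series_sum:
  assumes "\<And>i. i \<in> I \<Longrightarrow> geom_bounded (a i)"
  shows "phi_series p (\<lambda>k. \<Sum>i\<in>I. c i * a i k) z = (\<Sum>i\<in>I. c i * phi_series p (a i) z)"
proof -
  have "(\<Sum>i\<in>I. c i * phi_series p (a i) z) = (\<Sum>i\<in>I. \<Sum>k. c i * (a i k * z ^ k / fact (k + p)))"
    unfolding phi_series_def by (intro sum.cong refl suminf_mult[symmetric] phi_summable assms)
  also have "\<dots> = (\<Sum>k. \<Sum>i\<in>I. c i * (a i k * z ^ k / fact (k + p)))"
    by (rule suminf_sum[symmetric]) (intro summable_mult phi_summable assms)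
  finally show ?thesis
    unfolding phi_series_def by (simp add: sum_distrib_right sum_divide_distrib mult.assoc)
qed

lemma phi_series_diff:
  "geom_bounded a \<Longrightarrow> geom_bounded b \<Longrightarrow>
    phi_series p (\<lambda>k. a k - b k) z = phi_series p a z - phi_series p b z"
  unfolding phi_series_def
  by (subst suminf_diff) (auto intro: phi_summable simp: left_diff_distrib diff_divide_distrib)

lemma phi_mat_mult_vec:
  assumes A: "A \<in> carrier_mat n n" and x: "x \<in> carrier_vec n" and i: "i < n"
  shows "(phi_mat p (z \<cdot>\<^sub>m A) *\<^sub>v x) $ i = phi_series p (\<lambda>k. ((A ^\<^sub>m k) *\<^sub>v x) $ i) z"
proof -
  have col: "((A ^\<^sub>m k) *\<^sub>v unit_vec n j) $ i = (A ^\<^sub>m k) $$ (i, j)" if "j < n" for j k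
    by (rule mult_mat_unit_vec[OF pow_carrier_mat[OF A] i that])
  have eb: "geom_bounded (\<lambda>k. (A ^\<^sub>m k) $$ (i, j))" if "j < n" for j
    using power_mult_vec_geom_bounded[OF A unit_vec_carrier i, of j] col[OF that] by simp
  have entry: "phi_mat p (z \<cdot>\<^sub>m A) $$ (i, j) = phi_series p (\<lambda>k. (A ^\<^sub>m k) $$ (i, j)) z"
    if j: "j < n" for j
  proof -
    have "((z \<cdot>\<^sub>m A) ^\<^sub>m k) $$ (i, j) = (A ^\<^sub>m k) $$ (i, j) * z ^ k" for k
    proof -
      have zA: "z \<cdot>\<^sub>m A \<in> carrier_mat n n" using A by simp
      have "((z \<cdot>\<^sub>m A) ^\<^sub>m k) $$ (i, j) = (((z \<cdot>\<^sub>m A) ^\<^sub>m k) *\<^sub>v unit_vec n j) $ i"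
        by (rule mult_mat_unit_vec[symmetric, OF pow_carrier_mat[OF zA] i j])
      also have "\<dots> = z ^ k * ((A ^\<^sub>m k) *\<^sub>v unit_vec n j) $ i"
        unfolding power_smult_mult_vec[OF A unit_vec_carrier]
        using i A by (simp del: index_mult_mat_vec)
      finally show ?thesis by (simp only: col[OF j] mult.commute)
    qed
    then show ?thesis using A i j by (simp add: phi_mat_def phi_series_def)
  qed
  have "phi_mat p (z \<cdot>\<^sub>m A) \<in> carrier_mat n n" using A by (simp add: phi_mat_def)
  from mult_mat_vec_entry[OF this x i]
  have "(phi_mat p (z \<cdot>\<^sub>m A) *\<^sub>v x) $ i = (\<Sum>j<n. x $ j * phi_series p (\<lambda>k. (A ^\<^sub>m k) $$ (i, j)) z)"
    using entry by (auto simp: mult.commute intro!: sum.cong)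
  also have "\<dots> = phi_series p (\<lambda>k. \<Sum>j<n. x $ j * (A ^\<^sub>m k) $$ (i, j)) z"
    by (rule phi_series_sum[symmetric]) (use eb in simp)
  also have "(\<lambda>k. \<Sum>j<n. x $ j * (A ^\<^sub>m k) $$ (i, j)) = (\<lambda>k. ((A ^\<^sub>m k) *\<^sub>v x) $ i)"
    using mult_mat_vec_entry[OF pow_carrier_mat[OF A] x i] by (simp only: mult.commute)
  finally show ?thesis .
qed

text \<open>Multiplying \<open>\<phi>\<^sub>p(t A)\<close> by \<open>t\<^sup>p\<close> turns it into an exponential generating function, with the coefficient
sequence delayed by \<open>p\<close>. Differentiating then lowers \<open>p\<close> by one, which replaces the integral
representation \<open>\<phi>\<^sub>p(z) = \<integral>\<^sub>0\<^sup>1 exp((1 - s) z) s\<^sup>p\<^sup>-\<^sup>1 / (p - 1)! ds\<close>.\<close>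

lemma egf_delay:
  assumes "geom_bounded a"
  shows "egf (\<lambda>k. if k < p then 0 else a (k - p)) t = of_real t ^ p * phi_series p a (of_real t)"
proof -
  let ?f = "\<lambda>k. (if k < p then 0 else a (k - p)) * complex_of_real t ^ k / fact k"
  have "egf (\<lambda>k. if k < p then 0 else a (k - p)) t = (\<Sum>k. ?f (k + p))"
    unfolding egf_def
    using suminf_split_initial_segment[OF egf_summable0[OF geom_bounded_delay[OF assms, of p], of "of_real t"], of p]
    by simp
  also have "\<dots> = (\<Sum>k. of_real t ^ p * (a k * of_real t ^ k / fact (k + p)))"
    by (simp add: power_add mult_ac)
  also have "\<dots> = of_real t ^ p * phi_series p a (of_real t)"
    unfolding phi_series_def by (rule suminf_mult[OF phi_summable[OF assms]])
  finally show ?thesis .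
qed

text \<open>On the unit disc every later power of \<open>z\<close> is dominated by \<open>z\<^sup>m\<^sup>+\<^sup>1\<close>, and the series of the coefficients
converges absolutely.\<close>

lemma phi_series_tail:
  assumes a: "geom_bounded a" and zero: "\<And>k. k < m \<Longrightarrow> a k = 0"
  obtains K where "0 \<le> K" "\<And>z. cmod z \<le> 1 \<Longrightarrow>
    cmod (phi_series p a z - a m * z ^ m / fact (m + p)) \<le> K * cmod z ^ (m + 1)"
proof
  let ?K = "\<Sum>k. cmod (a k / fact (k + p))"
  have sK: "summable (\<lambda>k. cmod (a k / fact (k + p)))"
    using egf_summable[OF a, of 1 p] by simp
  show "0 \<le> ?K" by (rule suminf_nonneg[OF sK]) simp
  fix z :: complex assume z: "cmod z \<le> 1"
  let ?f = "\<lambda>k. a k * z ^ k / fact (k + p)"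
  have s: "summable ?f" by (rule phi_summable[OF a])
  have "phi_series p a z = (\<Sum>k. ?f (k + Suc m)) + (\<Sum>k<Suc m. ?f k)"
    unfolding phi_series_def by (rule suminf_split_initial_segment[OF s])
  also have "(\<Sum>k<Suc m. ?f k) = ?f m" using zero by simp
  finally have "phi_series p a z - ?f m = (\<Sum>k. ?f (k + Suc m))" by simp
  also have "cmod \<dots> \<le> (\<Sum>k. cmod z ^ (m + 1) * cmod (a (k + Suc m) / fact (k + Suc m + p)))"
  proof (rule norm_suminf_le)
    fix k
    have "cmod z ^ (k + Suc m) \<le> cmod z ^ (m + 1)"
      using z by (intro power_decreasing) auto
    then have "cmod (a (k + Suc m) / fact (k + Suc m + p)) * cmod z ^ (k + Suc m)
        \<le> cmod (a (k + Suc m) / fact (k + Suc m + p)) * cmod z ^ (m + 1)"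
      by (rule mult_left_mono) simp
    moreover have "cmod (?f (k + Suc m)) = cmod (a (k + Suc m) / fact (k + Suc m + p)) * cmod z ^ (k + Suc m)"
      by (simp only: norm_mult norm_divide norm_power times_divide_eq_left)
    ultimately show "cmod (?f (k + Suc m)) \<le> cmod z ^ (m + 1) * cmod (a (k + Suc m) / fact (k + Suc m + p))"
      by (simp only: mult.commute)
    show "summable (\<lambda>k. cmod z ^ (m + 1) * cmod (a (k + Suc m) / fact (k + Suc m + p)))"
      by (intro summable_mult summable_ignore_initial_segment[OF sK])
  qed
  also have "\<dots> = cmod z ^ (m + 1) * (\<Sum>k. cmod (a (k + Suc m) / fact (k + Suc m + p)))"
    by (intro suminf_mult summable_ignore_initial_segment[OF sK])
  also have "\<dots> \<le> cmod z ^ (m + 1) * ?K"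
  proof (rule mult_left_mono)
    have "?K = (\<Sum>k. cmod (a (k + Suc m) / fact (k + Suc m + p))) + (\<Sum>k<Suc m. cmod (a k / fact (k + p)))"
      by (rule suminf_split_initial_segment[OF sK])
    moreover have "0 \<le> (\<Sum>k<Suc m. cmod (a k / fact (k + p)))" by (rule sum_nonneg) simp
    ultimately show "(\<Sum>k. cmod (a (k + Suc m) / fact (k + Suc m + p))) \<le> ?K" by linarith
  qed simp
  finally show "cmod (phi_series p a z - ?f m) \<le> ?K * cmod z ^ (m + 1)" by (simp add: mult.commute)
qed

section \<open>The defect of an Arnoldi relation\<close>

text \<open>The expansion of the error is driven by the rank-one defect of \<open>V\<close> from being invariant under \<open>M\<close>,
and by the Hessenberg shape of \<open>N\<close>. The matrices are meant to be \<open>\<sigma> A\<close> and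
\<open>\<sigma> T\<close>; absorbing \<open>\<sigma>\<close> makes the constant \<open>c = \<sigma> \<tau>\<close> complex and leaves \<open>t\<close> as the only scalar
in the power series.\<close>

locale arnoldi_relation =
  fixes n m :: nat and M N V :: "complex mat" and w :: "complex vec" and c :: complex
  assumes M: "M \<in> carrier_mat n n" and N: "N \<in> carrier_mat m m" and V: "V \<in> carrier_mat n m"
    and w: "w \<in> carrier_vec n" and m_pos: "1 \<le> m"
    and hessenberg: "\<forall>i<m. \<forall>j<m. j + 1 < i \<longrightarrow> N $$ (i, j) = 0"
    and relation: "M * V = V * N + c \<cdot>\<^sub>m (mat_of_cols n [w] * mat_of_rows m [unit_vec m (m - 1)])"
begin

text \<open>The exponential generating function of \<open>residual\<close> is \<open>e\<^sub>m\<^sup>* exp(t N) e\<^sub>1\<close>, and that of \<open>defect i\<close> is the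
component \<open>i\<close> of the error \<open>exp(t M) v - V exp(t N) e\<^sub>1\<close>.\<close>

definition residual :: "nat \<Rightarrow> complex" where
  "residual k = ((N ^\<^sub>m k) *\<^sub>v unit_vec m 0) $ (m - 1)"

definition defect :: "nat \<Rightarrow> nat \<Rightarrow> complex" where
  "defect i k = ((M ^\<^sub>m k) *\<^sub>v col V 0) $ i - (V *\<^sub>v ((N ^\<^sub>m k) *\<^sub>v unit_vec m 0)) $ i"

lemma col0: "col V 0 \<in> carrier_vec n"
  using V by auto

lemma NK: "(N ^\<^sub>m k) *\<^sub>v unit_vec m 0 \<in> carrier_vec m"
  by (rule power_mult_vec_carrier[OF N]) simp

lemma relation_entry:
  assumes y: "y \<in> carrier_vec m" and i: "i < n"
  shows "(M *\<^sub>v (V *\<^sub>v y)) $ i = (V *\<^sub>v (N *\<^sub>v y)) $ i + c * y $ (m - 1) * w $ i"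
proof -
  have entry: "(M * V) $$ (i, j) = (V * N) $$ (i, j) + (if j = m - 1 then c * w $ i else 0)"
    if j: "j < m" for j
    unfolding relation using V N w i j
    by (auto simp: mat_of_cols_def mat_of_rows_def scalar_prod_def)
  have "(M *\<^sub>v (V *\<^sub>v y)) $ i = ((M * V) *\<^sub>v y) $ i"
    using assoc_mult_mat_vec[OF M V y] by simp
  also have "\<dots> = (\<Sum>j<m. (M * V) $$ (i, j) * y $ j)"
    by (rule mult_mat_vec_entry[OF mult_carrier_mat[OF M V] y i])
  also have "\<dots> = (\<Sum>j<m. (V * N) $$ (i, j) * y $ j + (if j = m - 1 then c * y $ (m - 1) * w $ i else 0))"
    by (rule sum.cong[OF refl]) (use entry in \<open>auto simp: algebra_simps simp del: index_mult_mat\<close>)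
  also have "\<dots> = ((V * N) *\<^sub>v y) $ i + c * y $ (m - 1) * w $ i"
    unfolding sum.distrib using mult_mat_vec_entry[OF mult_carrier_mat[OF V N] y i] m_pos by simp
  also have "((V * N) *\<^sub>v y) $ i = (V *\<^sub>v (N *\<^sub>v y)) $ i"
    using assoc_mult_mat_vec[OF V N y] by simp
  finally show ?thesis .
qed

lemma residual_entry: "residual k = (N ^\<^sub>m k) $$ (m - 1, 0)"
  unfolding residual_def by (rule mult_mat_unit_vec[OF pow_carrier_mat[OF N]]) (use m_pos in auto)

text \<open>Each multiplication with a Hessenberg matrix moves the support of \<open>e\<^sub>1\<close> down by one place at most, so
\<open>m - 1\<close> steps are needed to reach the last component.\<close>

lemma residual_zero: "k < m - 1 \<Longrightarrow> residual k = 0"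
  unfolding residual_entry using hessenberg_power_entry[OF N hessenberg, of k "m - 1"] m_pos by simp

text \<open>On the level of coefficients this is the differential equation \<open>L' = M L + c (e\<^sub>m\<^sup>* exp(t N) e\<^sub>1) w\<close> of the
error.\<close>

lemma defect_Suc:
  assumes i: "i < n"
  shows "defect i (Suc k) = (\<Sum>j<n. M $$ (i, j) * defect j k) + c * w $ i * residual k"
proof -
  let ?x = "(M ^\<^sub>m k) *\<^sub>v col V 0" and ?y = "(N ^\<^sub>m k) *\<^sub>v unit_vec m 0"
  have x: "?x \<in> carrier_vec n" by (rule power_mult_vec_carrier[OF M col0])
  have Vy: "V *\<^sub>v ?y \<in> carrier_vec n" using V NK by simp
  have "defect i (Suc k) = (M *\<^sub>v ?x) $ i - (V *\<^sub>v (N *\<^sub>v ?y)) $ i"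
    unfolding defect_def power_Suc_mult_vec[OF M col0] power_Suc_mult_vec[OF N unit_vec_carrier] ..
  also have "\<dots> = (M *\<^sub>v ?x) $ i - (M *\<^sub>v (V *\<^sub>v ?y)) $ i + c * w $ i * residual k"
    unfolding relation_entry[OF NK i] residual_def by simp
  also have "(M *\<^sub>v ?x) $ i - (M *\<^sub>v (V *\<^sub>v ?y)) $ i = (\<Sum>j<n. M $$ (i, j) * defect j k)"
    unfolding mult_mat_vec_entry[OF M x i] mult_mat_vec_entry[OF M Vy i] defect_def
    by (simp only: right_diff_distrib sum_subtractf)
  finally show ?thesis .
qed

lemma defect_0:
  assumes "i < n" shows "defect i 0 = 0"
proof -
  have "((M ^\<^sub>m 0) *\<^sub>v col V 0) $ i = V $$ (i, 0)"
    using M V col0 assms m_pos by simp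
  moreover have "(V *\<^sub>v ((N ^\<^sub>m 0) *\<^sub>v unit_vec m 0)) $ i = V $$ (i, 0)"
    using mult_mat_unit_vec[OF V assms, of 0] N m_pos by simp
  ultimately show ?thesis by (simp add: defect_def)
qed

text \<open>The Krylov approximation is exact on polynomials of degree below \<open>m\<close>; the recurrence shows this
because its forcing term vanishes up to index \<open>m - 2\<close>.\<close>

lemma defect_zero: "i < n \<Longrightarrow> k < m \<Longrightarrow> defect i k = 0"
proof (induction k arbitrary: i)
  case (Suc k)
  then show ?case using defect_Suc[of i k] residual_zero[of k] by simp
qed (rule defect_0)

lemma defect_leading:
  assumes i: "i < n" shows "defect i m = c * w $ i * residual (m - 1)"
proof -
  obtain k where k: "m = Suc k" using m_pos by (cases m) auto
  show ?thesis using defect_Suc[OF i, of k] defect_zero[of _ k] by (simp add: k)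
qed

lemma residual_geom_bounded: "geom_bounded residual"
  unfolding residual_def[abs_def]
  by (rule power_mult_vec_geom_bounded[OF N unit_vec_carrier]) (use m_pos in simp)

lemma projected_geom_bounded:
  "i < n \<Longrightarrow> geom_bounded (\<lambda>k. (V *\<^sub>v ((N ^\<^sub>m k) *\<^sub>v unit_vec m 0)) $ i)"
  unfolding mult_mat_vec_entry[OF V NK]
  by (intro geom_bounded_sum geom_bounded_cmult power_mult_vec_geom_bounded[OF N unit_vec_carrier]) simp

lemma defect_geom_bounded: "i < n \<Longrightarrow> geom_bounded (defect i)"
  unfolding defect_def[abs_def]
  by (intro geom_bounded_diff power_mult_vec_geom_bounded[OF M col0] projected_geom_bounded)

lemma phi_series_defect:
  assumes i: "i < n"
  shows "(phi_mat p (z \<cdot>\<^sub>m M) *\<^sub>v col V 0 - V *\<^sub>v (phi_mat p (z \<cdot>\<^sub>m N) *\<^sub>v unit_vec m 0)) $ i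
    = phi_series p (defect i) z"
proof -
  have phiN: "phi_mat p (z \<cdot>\<^sub>m N) *\<^sub>v unit_vec m 0 \<in> carrier_vec m"
    by (rule mult_mat_vec_carrier[of _ m m]) (use N in \<open>simp_all add: phi_mat_def\<close>)
  have "(V *\<^sub>v (phi_mat p (z \<cdot>\<^sub>m N) *\<^sub>v unit_vec m 0)) $ i =
      (\<Sum>j<m. V $$ (i, j) * phi_series p (\<lambda>k. ((N ^\<^sub>m k) *\<^sub>v unit_vec m 0) $ j) z)"
    unfolding mult_mat_vec_entry[OF V phiN i]
    by (rule sum.cong[OF refl]) (simp only: phi_mat_mult_vec[OF N unit_vec_carrier] lessThan_iff)
  also have "\<dots> = phi_series p (\<lambda>k. (V *\<^sub>v ((N ^\<^sub>m k) *\<^sub>v unit_vec m 0)) $ i) z"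
    unfolding mult_mat_vec_entry[OF V NK i]
    by (rule phi_series_sum[symmetric]) (intro power_mult_vec_geom_bounded[OF N unit_vec_carrier], simp)
  finally have VN: "(V *\<^sub>v (phi_mat p (z \<cdot>\<^sub>m N) *\<^sub>v unit_vec m 0)) $ i =
      phi_series p (\<lambda>k. (V *\<^sub>v ((N ^\<^sub>m k) *\<^sub>v unit_vec m 0)) $ i) z" .
  have "(phi_mat p (z \<cdot>\<^sub>m M) *\<^sub>v col V 0 - V *\<^sub>v (phi_mat p (z \<cdot>\<^sub>m N) *\<^sub>v unit_vec m 0)) $ i
      = (phi_mat p (z \<cdot>\<^sub>m M) *\<^sub>v col V 0) $ i - (V *\<^sub>v (phi_mat p (z \<cdot>\<^sub>m N) *\<^sub>v unit_vec m 0)) $ i"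
    using V i by (simp del: index_mult_mat_vec)
  also have "\<dots> = phi_series p (defect i) z"
    unfolding VN phi_mat_mult_vec[OF M col0 i] defect_def[abs_def]
    by (rule phi_series_diff[symmetric])
      (intro power_mult_vec_geom_bounded[OF M col0 i] projected_geom_bounded[OF i])+
  finally show ?thesis .
qed

lemma defect_expansion:
  obtains K where "\<And>z. cmod z \<le> 1 \<Longrightarrow>
    L2_set (\<lambda>i. cmod (phi_series p (defect i) z
      - c * residual (m - 1) * z ^ m / fact (m + p) * w $ i)) {..<n} \<le> K * cmod z ^ (m + 1)"
proof -
  have "\<exists>K. \<forall>z. cmod z \<le> 1 \<longrightarrow>
      cmod (phi_series p (defect i) z - defect i m * z ^ m / fact (m + p)) \<le> K * cmod z ^ (m + 1)"
    if i: "i < n" for i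
    using phi_series_tail[OF defect_geom_bounded[OF i], of m p] defect_zero[OF i] by metis
  then obtain K where K: "\<And>i z. i < n \<Longrightarrow> cmod z \<le> 1 \<Longrightarrow>
      cmod (phi_series p (defect i) z - defect i m * z ^ m / fact (m + p)) \<le> K i * cmod z ^ (m + 1)"
    by metis
  show thesis
  proof
    fix z :: complex assume z: "cmod z \<le> 1"
    have "L2_set (\<lambda>i. cmod (phi_series p (defect i) z
          - c * residual (m - 1) * z ^ m / fact (m + p) * w $ i)) {..<n}
        \<le> (\<Sum>i<n. cmod (phi_series p (defect i) z
          - c * residual (m - 1) * z ^ m / fact (m + p) * w $ i))"
      by (rule L2_set_le_sum) simp
    also have "\<dots> \<le> (\<Sum>i<n. K i * cmod z ^ (m + 1))"
    proof (rule sum_mono)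
      fix i assume "i \<in> {..<n}"
      then have i: "i < n" by simp
      have eq: "c * residual (m - 1) * z ^ m / fact (m + p) * w $ i = defect i m * z ^ m / fact (m + p)"
        unfolding defect_leading[OF i] by simp
      show "cmod (phi_series p (defect i) z
          - c * residual (m - 1) * z ^ m / fact (m + p) * w $ i) \<le> K i * cmod z ^ (m + 1)"
        unfolding eq by (rule K[OF i z])
    qed
    finally show "L2_set (\<lambda>i. cmod (phi_series p (defect i) z
        - c * residual (m - 1) * z ^ m / fact (m + p) * w $ i)) {..<n} \<le> (\<Sum>i<n. K i) * cmod z ^ (m + 1)"
      by (simp add: sum_distrib_right)
  qed
qed

end

text \<open>Dissipativity is needed twice: for \<open>N\<close> to control the residual, and for \<open>M\<close> to propagate the
residual into the error. For a compression \<open>N = V\<^sup>* M V\<close> the former follows from the latter by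
\<open>dissipative_compression\<close>.\<close>

locale dissipative_arnoldi_relation = arnoldi_relation +
  assumes w_norm: "vec_norm2 w = 1"
    and dissM: "\<And>x. x \<in> carrier_vec n \<Longrightarrow> Re (\<Sum>i<n. cnj (x $ i) * (M *\<^sub>v x) $ i) \<le> 0"
    and dissN: "\<And>x. x \<in> carrier_vec m \<Longrightarrow> Re (\<Sum>i<m. cnj (x $ i) * (N *\<^sub>v x) $ i) \<le> 0"
begin

text \<open>The last component of \<open>exp(t N) e\<^sub>1\<close> satisfies the linear recurrence with the eigenvalues of \<open>N\<close> as
characteristic roots, and these lie in the left half-plane because the form of \<open>N\<close> is dissipative.\<close>

lemma egf_residual_bound:
  assumes t: "0 \<le> t"
  shows "cmod (egf residual t) \<le> cmod (residual (m - 1)) * t ^ (m - 1) / fact (m - 1)"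
proof -
  obtain \<mu>s where \<mu>s: "length \<mu>s = m" "\<And>\<mu>. \<mu> \<in> set \<mu>s \<Longrightarrow> eigenvalue N \<mu>"
    and ann: "\<And>x i. x \<in> carrier_vec m \<Longrightarrow> i < m \<Longrightarrow> annihilated \<mu>s (\<lambda>k. ((N ^\<^sub>m k) *\<^sub>v x) $ i)"
    using power_entries_annihilated[OF N] by blast
  show ?thesis
  proof (rule egf_stable_recurrence_bound)
    show "annihilated \<mu>s residual"
      unfolding residual_def[abs_def] by (rule ann) (use m_pos in auto)
    show "length \<mu>s = Suc (m - 1)" using \<mu>s(1) m_pos by simp
    show "Re \<mu> \<le> 0" if "\<mu> \<in> set \<mu>s" for \<mu>
      by (rule eigenvalue_Re_nonpos[OF N dissN \<mu>s(2)[OF that]])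
  qed (use residual_geom_bounded residual_zero t in auto)
qed

text \<open>For \<open>p = 0\<close> the error solves a dissipative equation forced by \<open>c\<close> times the residual, and the bound
is the integral of the bound for the residual. Raising \<open>p\<close> by one integrates the error from \<open>0\<close> to
\<open>t\<close>, and the bound with it.\<close>

lemma egf_defect_bound:
  assumes "0 \<le> t"
  shows "L2_set (\<lambda>i. cmod (egf (\<lambda>k. if k < p then 0 else defect i (k - p)) t)) {..<n}
    \<le> cmod c * cmod (residual (m - 1)) * t ^ (m + p) / fact (m + p)"
  using assms
proof (induction p arbitrary: t)
  case 0
  define r where "r = cmod c * cmod (residual (m - 1))"
  define F where "F s = egf residual s" for s
  define Y where "Y i s = egf (defect i) s" for i s
  define Y' where "Y' i s = (\<Sum>j<n. M $$ (i, j) * Y j s) + c * w $ i * F s" for i s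
  have deriv: "(Y i has_vector_derivative Y' i s) (at s)" if i: "i < n" for i s
  proof -
    have eb: "geom_bounded (\<lambda>k. M $$ (i, j) * defect j k)" if "j \<in> {..<n}" for j
      using geom_bounded_cmult[OF defect_geom_bounded, of j] that by simp
    have "egf (\<lambda>k. defect i (Suc k)) s =
        egf (\<lambda>k. \<Sum>j<n. M $$ (i, j) * defect j k) s + egf (\<lambda>k. c * w $ i * residual k) s"
      unfolding defect_Suc[OF i]
      by (rule egf_add[OF geom_bounded_sum[OF eb] geom_bounded_cmult[OF residual_geom_bounded]])
    also have "egf (\<lambda>k. \<Sum>j<n. M $$ (i, j) * defect j k) s
        = (\<Sum>j<n. egf (\<lambda>k. M $$ (i, j) * defect j k) s)"
      by (rule egf_sum[OF eb])
    also have "\<dots> = (\<Sum>j<n. M $$ (i, j) * Y j s)"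
      unfolding Y_def
      by (rule sum.cong[OF refl], rule egf_cmult, rule defect_geom_bounded) simp
    also have "egf (\<lambda>k. c * w $ i * residual k) s = c * w $ i * F s"
      unfolding F_def by (rule egf_cmult[OF residual_geom_bounded])
    finally have "egf (\<lambda>k. defect i (Suc k)) s = Y' i s" unfolding Y'_def .
    then show ?thesis using egf_deriv[OF defect_geom_bounded[OF i], of s] unfolding Y_def[abs_def] by simp
  qed
  have "L2_set (\<lambda>i. cmod (Y i t)) {..<n} \<le> L2_set (\<lambda>i. cmod (Y i 0)) {..<n}
      + r * t ^ m / fact m - r * 0 ^ m / fact m"
  proof (rule L2_growth_bound[where y' = Y' and b = "\<lambda>s. r * s ^ m / fact m"
        and b' = "\<lambda>s. r * s ^ (m - 1) / fact (m - 1)"])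
    fix s :: real assume s: "0 \<le> s"
    show "((\<lambda>s. r * s ^ m / fact m) has_real_derivative r * s ^ (m - 1) / fact (m - 1)) (at s)"
      using has_real_derivative_power_div_fact[of r "m - 1" s] m_pos by simp
    show "0 \<le> r * s ^ (m - 1) / fact (m - 1)" using s by (simp add: r_def)
    \<comment> \<open>The dissipativity of \<open>M\<close> removes the homogeneous part of the equation from the energy balance.\<close>
    define x where "x = vec n (\<lambda>i. Y i s)"
    have x: "x \<in> carrier_vec n" by (simp add: x_def)
    have "(\<Sum>i<n. cnj (Y i s) * Y' i s) =
        (\<Sum>i<n. cnj (x $ i) * (M *\<^sub>v x) $ i) + (\<Sum>i<n. cnj (Y i s) * (c * F s * w $ i))"
      unfolding sum.distrib[symmetric]
    proof (rule sum.cong[OF refl])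
      fix i assume "i \<in> {..<n}"
      then have i: "i < n" by simp
      have "(M *\<^sub>v x) $ i = (\<Sum>j<n. M $$ (i, j) * Y j s)"
        unfolding mult_mat_vec_entry[OF M x i] by (simp add: x_def)
      then show "cnj (Y i s) * Y' i s = cnj (x $ i) * (M *\<^sub>v x) $ i + cnj (Y i s) * (c * F s * w $ i)"
        using i by (simp add: Y'_def x_def algebra_simps)
    qed
    then have "Re (\<Sum>i<n. cnj (Y i s) * Y' i s) \<le> Re (\<Sum>i<n. cnj (Y i s) * (c * F s * w $ i))"
      using dissM[OF x] by simp
    also have "\<dots> \<le> cmod (\<Sum>i<n. cnj (Y i s) * (c * F s * w $ i))" by (rule complex_Re_le_cmod)
    also have "\<dots> \<le> L2_set (\<lambda>i. cmod (Y i s)) {..<n} * L2_set (\<lambda>i. cmod (c * F s * w $ i)) {..<n}"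
      by (rule cmod_sum_cnj_mult_le)
    also have "L2_set (\<lambda>i. cmod (c * F s * w $ i)) {..<n} = cmod (c * F s)"
      unfolding L2_set_cmod_cmult vec_norm2_carrier[OF w, symmetric] w_norm by simp
    also have "L2_set (\<lambda>i. cmod (Y i s)) {..<n} * cmod (c * F s)
        \<le> L2_set (\<lambda>i. cmod (Y i s)) {..<n} * (r * s ^ (m - 1) / fact (m - 1))"
    proof (rule mult_left_mono)
      have "cmod (c * F s) \<le> cmod c * (cmod (residual (m - 1)) * s ^ (m - 1) / fact (m - 1))"
        unfolding norm_mult F_def by (intro mult_left_mono egf_residual_bound s) simp
      then show "cmod (c * F s) \<le> r * s ^ (m - 1) / fact (m - 1)" by (simp add: r_def mult.assoc)
    qed simp
    finally show "Re (\<Sum>i<n. cnj (Y i s) * Y' i s)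
        \<le> L2_set (\<lambda>i. cmod (Y i s)) {..<n} * (r * s ^ (m - 1) / fact (m - 1))" .
  qed (use deriv 0 in auto)
  moreover have "L2_set (\<lambda>i. cmod (Y i 0)) {..<n} = 0"
    by (rule L2_set_0') (simp add: Y_def egf_0 defect_0)
  ultimately show ?case using m_pos by (simp add: Y_def r_def power_0_left)
next
  case (Suc p)
  define r where "r = cmod c * cmod (residual (m - 1))"
  define D where "D q i k = (if k < q then 0 else defect i (k - q))" for q i k
  have deriv: "(egf (D (Suc p) i) has_vector_derivative egf (D p i) s) (at s)" if i: "i < n" for i s
  proof -
    have "geom_bounded (D (Suc p) i)"
      unfolding D_def[abs_def] by (rule geom_bounded_delay[OF defect_geom_bounded[OF i]])
    moreover have "(\<lambda>k. D (Suc p) i (Suc k)) = D p i" by (simp add: D_def fun_eq_iff)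
    ultimately show ?thesis using egf_deriv[of "D (Suc p) i" s] by simp
  qed
  have "L2_set (\<lambda>i. cmod (egf (D (Suc p) i) t)) {..<n} \<le> L2_set (\<lambda>i. cmod (egf (D (Suc p) i) 0)) {..<n}
      + r * t ^ Suc (m + p) / fact (Suc (m + p)) - r * 0 ^ Suc (m + p) / fact (Suc (m + p))"
  proof (rule L2_growth_bound[where y' = "\<lambda>i. egf (D p i)" and b = "\<lambda>s. r * s ^ Suc (m + p) / fact (Suc (m + p))"
        and b' = "\<lambda>s. r * s ^ (m + p) / fact (m + p)"])
    fix s :: real assume s: "0 \<le> s"
    show "((\<lambda>s. r * s ^ Suc (m + p) / fact (Suc (m + p))) has_real_derivative
        r * s ^ (m + p) / fact (m + p)) (at s)"
      by (rule has_real_derivative_power_div_fact)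
    show "0 \<le> r * s ^ (m + p) / fact (m + p)" using s by (simp add: r_def)
    have "Re (\<Sum>i<n. cnj (egf (D (Suc p) i) s) * egf (D p i) s)
        \<le> cmod (\<Sum>i<n. cnj (egf (D (Suc p) i) s) * egf (D p i) s)" by (rule complex_Re_le_cmod)
    also have "\<dots> \<le> L2_set (\<lambda>i. cmod (egf (D (Suc p) i) s)) {..<n} * L2_set (\<lambda>i. cmod (egf (D p i) s)) {..<n}"
      by (rule cmod_sum_cnj_mult_le)
    also have "\<dots> \<le> L2_set (\<lambda>i. cmod (egf (D (Suc p) i) s)) {..<n} * (r * s ^ (m + p) / fact (m + p))"
      using Suc.IH[OF s] unfolding D_def[abs_def] r_def by (rule mult_left_mono) simp
    finally show "Re (\<Sum>i<n. cnj (egf (D (Suc p) i) s) * egf (D p i) s)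
        \<le> L2_set (\<lambda>i. cmod (egf (D (Suc p) i) s)) {..<n} * (r * s ^ (m + p) / fact (m + p))" .
  qed (use deriv Suc.prems in auto)
  moreover have "L2_set (\<lambda>i. cmod (egf (D (Suc p) i) 0)) {..<n} = 0"
    by (rule L2_set_0') (simp add: egf_0 D_def)
  ultimately show ?case by (simp add: D_def[abs_def] r_def)
qed

lemma phi_series_defect_bound:
  assumes t: "0 \<le> t"
  shows "L2_set (\<lambda>i. cmod (phi_series p (defect i) (of_real t))) {..<n}
    \<le> cmod c * cmod (residual (m - 1)) * t ^ m / fact (m + p)"
proof (cases "t = 0")
  case True
  have "phi_series p (defect i) 0 = 0" if "i < n" for i
  proof -
    have "phi_series p (defect i) 0 = defect i 0 / fact p"
      unfolding phi_series_def
      using suminf_finite[of "{0}" "\<lambda>k. defect i k * 0 ^ k / fact (k + p)"] by simp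
    then show ?thesis by (simp add: defect_0[OF that])
  qed
  then show ?thesis using True by (simp add: L2_set_0')
next
  case False
  \<comment> \<open>The bound for the delayed series carries a factor \<open>t\<^sup>p\<close>, which is cancelled here.\<close>
  then have t: "0 < t" using assms by simp
  let ?L = "L2_set (\<lambda>i. cmod (phi_series p (defect i) (of_real t))) {..<n}"
  have "L2_set (\<lambda>i. cmod (egf (\<lambda>k. if k < p then 0 else defect i (k - p)) t)) {..<n}
      = L2_set (\<lambda>i. cmod (of_real t ^ p * phi_series p (defect i) (of_real t))) {..<n}"
    by (rule L2_set_cong) (auto simp: egf_delay defect_geom_bounded)
  also have "\<dots> = t ^ p * ?L"
    unfolding L2_set_cmod_cmult norm_power norm_of_real using t by simp
  finally have "t ^ p * ?L \<le> t ^ p * (cmod c * cmod (residual (m - 1)) * t ^ m / fact (m + p))"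
    using egf_defect_bound[OF assms, of p] by (simp add: power_add mult_ac)
  then show ?thesis by (rule mult_left_le_imp_le) (use t in simp)
qed

end

section \<open>The error of the Krylov approximation\<close>

lemma vec_norm2_reverse_triangle:
  assumes x: "x \<in> carrier_vec n" and y: "y \<in> carrier_vec n"
  shows "\<bar>vec_norm2 x - vec_norm2 y\<bar> \<le> vec_norm2 (x - y)"
proof -
  have d: "x - y \<in> carrier_vec n" using x y by simp
  have "x = (x - y) + y" "y = (-1) \<cdot>\<^sub>v (x - y) + x"
    using x y by (auto intro!: eq_vecI)
  moreover have "vec_norm2 ((-1) \<cdot>\<^sub>v (x - y)) = vec_norm2 (x - y)"
    unfolding vec_norm2_smult by simp
  ultimately show ?thesis
    using vec_norm2_triangle[OF d y] vec_norm2_triangle[OF smult_carrier_vec[THEN iffD2, OF d] x, of "-1"]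
    by simp
qed

lemma krylov_decomposition_arnoldi_relation:
  assumes A: "A \<in> carrier_mat n n" and m: "1 \<le> m" and K: "krylov_decomposition n m A v V T \<tau> w"
  shows "arnoldi_relation n m (\<sigma> \<cdot>\<^sub>m A) (\<sigma> \<cdot>\<^sub>m T) V w (\<sigma> * complex_of_real \<tau>)"
proof
  have V: "V \<in> carrier_mat n m" and T: "T = mat_adjoint V * A * V"
    and w: "w \<in> carrier_vec n"
    and hess: "\<forall>i<m. \<forall>j<m. j + 1 < i \<longrightarrow> T $$ (i, j) = 0"
    and rel: "A * V = V * T + complex_of_real \<tau> \<cdot>\<^sub>m (mat_of_cols n [w] * mat_of_rows m [unit_vec m (m - 1)])"
    using K unfolding krylov_decomposition_def by auto
  have Tc: "T \<in> carrier_mat m m" using V T by (auto simp: mat_adjoint_def)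
  show "\<sigma> \<cdot>\<^sub>m A \<in> carrier_mat n n" "\<sigma> \<cdot>\<^sub>m T \<in> carrier_mat m m" using A Tc by simp_all
  show "V \<in> carrier_mat n m" "w \<in> carrier_vec n" "1 \<le> m" by (fact V w m)+
  show "\<forall>i<m. \<forall>j<m. j + 1 < i \<longrightarrow> (\<sigma> \<cdot>\<^sub>m T) $$ (i, j) = 0" using hess Tc by auto
  let ?E = "mat_of_cols n [w] * mat_of_rows m [unit_vec m (m - 1)]"
  have E: "?E \<in> carrier_mat n m" by (rule carrier_matI) simp_all
  have "(\<sigma> \<cdot>\<^sub>m A) * V = \<sigma> \<cdot>\<^sub>m (V * T + complex_of_real \<tau> \<cdot>\<^sub>m ?E)"
    unfolding mult_smult_assoc_mat[OF A V] rel ..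
  also have "\<dots> = \<sigma> \<cdot>\<^sub>m (V * T) + \<sigma> \<cdot>\<^sub>m (complex_of_real \<tau> \<cdot>\<^sub>m ?E)"
    by (rule add_smult_distrib_left_mat[OF mult_carrier_mat[OF V Tc]]) (use E in simp)
  also have "\<sigma> \<cdot>\<^sub>m (V * T) = V * (\<sigma> \<cdot>\<^sub>m T)" by (rule mult_smult_distrib[OF V Tc, symmetric])
  also have "\<sigma> \<cdot>\<^sub>m (complex_of_real \<tau> \<cdot>\<^sub>m ?E) = (\<sigma> * complex_of_real \<tau>) \<cdot>\<^sub>m ?E"
    by (rule eq_matI) (auto simp: mult.assoc simp del: index_mult_mat(1))
  finally show "(\<sigma> \<cdot>\<^sub>m A) * V = V * (\<sigma> \<cdot>\<^sub>m T) + (\<sigma> * complex_of_real \<tau>) \<cdot>\<^sub>m ?E" .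
qed

theorem theorem2:
  fixes n m p :: nat and A V T :: "complex mat" and v w :: "complex vec"
    and \<sigma> :: complex and \<tau> :: real
  assumes "A \<in> carrier_mat n n"
    and "cmod \<sigma> = 1"
    and "v \<in> carrier_vec n" and "vec_norm2 v = 1"
    and "1 \<le> m"
    and "krylov_decomposition n m A v V T \<tau> w"
  shows "(\<lambda>t. vec_norm2 (krylov_error p m \<sigma> A v V T t -
            (complex_of_real (\<tau> * krylov_gamma m T) * (\<sigma> * complex_of_real t) ^ m / fact (m + p)) \<cdot>\<^sub>v w))
          \<in> O[at_right 0](\<lambda>t. t ^ (m + 1))
       \<and> (log_norm2 (\<sigma> \<cdot>\<^sub>m A) \<le> 0 \<longrightarrow>
            (\<forall>t\<ge>0. vec_norm2 (krylov_error p m \<sigma> A v V T t)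
                     \<le> \<tau> * krylov_gamma m T * t ^ m / fact (m + p)) \<and>
            (\<lambda>t. vec_norm2 (krylov_error p m \<sigma> A v V T t) - \<tau> * krylov_gamma m T * t ^ m / fact (m + p))
              \<in> O[at_right 0](\<lambda>t. t ^ (m + 1)))"
proof -
  define M where "M = \<sigma> \<cdot>\<^sub>m A"
  define N where "N = \<sigma> \<cdot>\<^sub>m T"
  define c where "c = \<sigma> * complex_of_real \<tau>"
  let ?\<gamma> = "krylov_gamma m T"
  have V: "V \<in> carrier_mat n m" and T: "T = mat_adjoint V * A * V" and v: "v = col V 0"
    and \<tau>: "0 < \<tau>" and w_unit: "vec_norm2 w = 1"
    using assms(6) unfolding krylov_decomposition_def by auto
  have \<gamma>: "0 < ?\<gamma>" "complex_of_real ?\<gamma> = (T ^\<^sub>m (m - 1)) $$ (m - 1, 0)"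
    using krylov_gamma_eq[OF assms(6,5)] by auto
  have adj: "mat_adjoint V \<in> carrier_mat m n" using V by (auto simp: mat_adjoint_def)
  have Tc: "T \<in> carrier_mat m m"
    unfolding T by (rule mult_carrier_mat[OF mult_carrier_mat[OF adj assms(1)] V])
  interpret arnoldi_relation n m M N V w c
    unfolding M_def N_def c_def
    by (rule krylov_decomposition_arnoldi_relation[OF assms(1,5,6)])
  have res: "residual (m - 1) = \<sigma> ^ (m - 1) * complex_of_real ?\<gamma>"
  proof -
    have "residual (m - 1) = (\<sigma> ^ (m - 1) \<cdot>\<^sub>v ((T ^\<^sub>m (m - 1)) *\<^sub>v unit_vec m 0)) $ (m - 1)"
      unfolding residual_def unfolding N_def power_smult_mult_vec[OF Tc unit_vec_carrier] ..
    also have "\<dots> = \<sigma> ^ (m - 1) * ((T ^\<^sub>m (m - 1)) *\<^sub>v unit_vec m 0) $ (m - 1)"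
      using Tc assms(5) by (simp del: index_mult_mat_vec)
    also have "((T ^\<^sub>m (m - 1)) *\<^sub>v unit_vec m 0) $ (m - 1) = complex_of_real ?\<gamma>"
      unfolding \<gamma>(2) by (rule mult_mat_unit_vec[OF pow_carrier_mat[OF Tc]]) (use assms(5) in auto)
    finally show ?thesis .
  qed
  \<comment> \<open>The factor \<open>\<sigma>\<close> of \<open>c\<close> supplies the missing power of \<open>\<sigma>\<close> in \<open>\<sigma>\<^sup>m\<close>.\<close>
  have lead: "c * residual (m - 1) * complex_of_real t ^ m
      = complex_of_real (\<tau> * ?\<gamma>) * (\<sigma> * complex_of_real t) ^ m" for t
  proof -
    obtain k where "m = Suc k" using assms(5) by (cases m) auto
    then show ?thesis unfolding c_def res by (simp add: power_mult_distrib mult_ac)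
  qed
  have size: "cmod c * cmod (residual (m - 1)) = \<tau> * ?\<gamma>"
    unfolding c_def res using assms(2) \<tau> \<gamma>(1) by (simp add: norm_mult norm_power)
  let ?err = "krylov_error p m \<sigma> A v V T"
  let ?lead = "\<lambda>t. (complex_of_real (\<tau> * ?\<gamma>) * (\<sigma> * complex_of_real t) ^ m / fact (m + p)) \<cdot>\<^sub>v w"
  have smult: "(\<sigma> * complex_of_real t) \<cdot>\<^sub>m B = complex_of_real t \<cdot>\<^sub>m (\<sigma> \<cdot>\<^sub>m B)" for t B
    by (rule eq_matI) (auto simp: mult_ac)
  have err: "?err t $ i = phi_series p (defect i) (complex_of_real t)" if "i < n" for t i
    unfolding krylov_error_def smult v M_def[symmetric] N_def[symmetric] by (rule phi_series_defect[OF that])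
  have err_dim: "?err t \<in> carrier_vec n" for t
    using V unfolding krylov_error_def by (intro carrier_vecI) simp
  have lead_dim: "?lead t \<in> carrier_vec n" for t using w by simp
  have norm_err: "vec_norm2 (?err t) = L2_set (\<lambda>i. cmod (phi_series p (defect i) (complex_of_real t))) {..<n}" for t
    unfolding vec_norm2_carrier[OF err_dim] by (rule L2_set_cong) (auto simp: err)
  have norm_lead: "vec_norm2 (?lead t) = \<tau> * ?\<gamma> * t ^ m / fact (m + p)" if "0 \<le> t" for t
    unfolding vec_norm2_smult w_unit using that \<tau> \<gamma>(1) assms(2)
    by (simp add: norm_mult norm_divide norm_power)
  obtain K where K: "\<And>z. cmod z \<le> 1 \<Longrightarrow>
      L2_set (\<lambda>i. cmod (phi_series p (defect i) z
        - c * residual (m - 1) * z ^ m / fact (m + p) * w $ i)) {..<n} \<le> K * cmod z ^ (m + 1)"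
    using defect_expansion[of p] by blast
  have diff: "vec_norm2 (?err t - ?lead t) \<le> K * t ^ (m + 1)" if t: "0 < t" "t < 1" for t
  proof -
    have "vec_norm2 (?err t - ?lead t) =
        L2_set (\<lambda>i. cmod (phi_series p (defect i) (complex_of_real t)
          - c * residual (m - 1) * complex_of_real t ^ m / fact (m + p) * w $ i)) {..<n}"
      unfolding vec_norm2_carrier[OF minus_carrier_vec[OF err_dim lead_dim]] lead
      by (rule L2_set_cong) (use w in \<open>auto simp: err\<close>)
    then show ?thesis using K[of "complex_of_real t"] t by simp
  qed
  have near0: "eventually (\<lambda>t. t \<in> {0<..<1::real}) (at_right 0)"
    by (rule eventually_at_right_real) simp
  have "(\<lambda>t. vec_norm2 (?err t - ?lead t)) \<in> O[at_right 0](\<lambda>t. t ^ (m + 1))"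
  proof (rule bigoI)
    show "eventually (\<lambda>t. norm (vec_norm2 (?err t - ?lead t)) \<le> K * norm (t ^ (m + 1))) (at_right 0)"
      using near0 by eventually_elim (use diff in \<open>simp add: vec_norm2_nonneg\<close>)
  qed
  moreover have "(\<lambda>t. vec_norm2 (?err t) - \<tau> * ?\<gamma> * t ^ m / fact (m + p)) \<in> O[at_right 0](\<lambda>t. t ^ (m + 1))"
  proof (rule bigoI)
    show "eventually (\<lambda>t. norm (vec_norm2 (?err t) - \<tau> * ?\<gamma> * t ^ m / fact (m + p))
        \<le> K * norm (t ^ (m + 1))) (at_right 0)"
      using near0
    proof eventually_elim
      case (elim t)
      have "\<bar>vec_norm2 (?err t) - vec_norm2 (?lead t)\<bar> \<le> vec_norm2 (?err t - ?lead t)"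
        by (rule vec_norm2_reverse_triangle[OF err_dim lead_dim])
      then show ?case using diff[of t] norm_lead[of t] elim by simp
    qed
  qed
  moreover have "vec_norm2 (?err t) \<le> \<tau> * ?\<gamma> * t ^ m / fact (m + p)"
    if mu: "log_norm2 (\<sigma> \<cdot>\<^sub>m A) \<le> 0" and t: "0 \<le> t" for t
  proof -
    have dissM: "Re (\<Sum>i<n. cnj (x $ i) * (M *\<^sub>v x) $ i) \<le> 0" if "x \<in> carrier_vec n" for x
      using dissipative_of_log_norm2_nonpos[OF M _ that] mu unfolding M_def by simp
    have "N = mat_adjoint V * M * V"
      unfolding N_def M_def T mult_smult_distrib[OF adj assms(1)]
        mult_smult_assoc_mat[OF mult_carrier_mat[OF adj assms(1)] V] ..
    then have dissN: "Re (\<Sum>i<m. cnj (x $ i) * (N *\<^sub>v x) $ i) \<le> 0" if "x \<in> carrier_vec m" for x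
      using dissipative_compression[OF M V dissM that] by simp
    interpret dissipative_arnoldi_relation n m M N V w c
      by unfold_locales (use w_unit dissM dissN in auto)
    show ?thesis unfolding norm_err using phi_series_defect_bound[OF t, of p] size by simp
  qed
  ultimately show ?thesis by blast
qed

end
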